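(* Let $G$ be a graph, let $u,v\in V(G)$ be distinct non-adjacent vertices, and let $S_a,S_b$ be two $uv$-separators of $G$. Then: (i) If $|S_a|=|S_b|=k$, the instance $TJ(G,S_a,S_b)$ has the same answer as the instance $TAR(G,S_a,S_b,k+1)$, which can be built from it in linear time, and $\mathrm{dist}_{TJ}(G,S_a,S_b)=\mathrm{dist}_{(k+1)\text{-}TAR}(G,S_a,S_b)/2$. (ii) If $S_a\neq S_b$, $|S_a|\le |S_b|=k$ and $S_b$ is a minimal $uv$-separator, then $TAR(G,S_a,S_b,k)$ is a NO-instance. (iii) If $|S_a|,|S_b|\le k$ and it is not the case that ($S_a\neq S_b$ and at least one of $S_a,S_b$ is a minimal $uv$-separator with exactly $k$ vertices), then the instance $TAR(G,S_a,S_b,k)$ has the same answer as some instance $TJ(G,S_a',S_b')$ that can be generated in polynomial time, and $\mathrm{dist}_{TJ}(G,S_a',S_b')=\mathrm{dist}_{k\text{-}TAR}(G,S_a',S_b')/2$.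
   Context: For distinct non-adjacent vertices $u,v$ of a graph $G$, a set $S\subseteq V(G)\setminus\{u,v\}$ is a $uv$-separator if $u$ and $v$ lie in different components of $G-S$; it is minimal if no proper subset is a $uv$-separator. A reconfiguration sequence is a sequence $\langle S_1,\dots,S_\ell\rangle$ of $uv$-separators in which consecutive sets are adjacent under the chosen rule. TJ (token jumping): $S,S'$ are adjacent if $|S|=|S'|$ and $|S\setminus S'|=|S'\setminus S|=1$. $k$-TAR (token addition/removal): $S,S'$ are adjacent if $|S\triangle S'|=1$ and $\max(|S|,|S'|)\le k$. $TJ(G,S_a,S_b)$ (resp. $TAR(G,S_a,S_b,k)$) asks whether there is a reconfiguration sequence from $S_a$ to $S_b$ under TJ (resp. $k$-TAR); for TAR the endpoints have size at most $k$. $\mathrm{dist}_X(G,S_a,S_b)$ denotes the minimum number of steps (adjacent-pair moves) in a reconfiguration sequence from $S_a$ to $S_b$ under rule $X$. Two instances are equivalent if they have the same answer. *)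

theory Defs
  imports "Graph_Theory.Graph_Theory" "HOL-Library.Extended_Real"
begin

section \<open>Separators\<close>

text \<open>
  Finite simple graphs are the finite, symmetric, loop-free digraphs \<^locale>\<open>pair_graph\<close>; their
  strongly connected components are the connected components of the undirected graph.
\<close>

definition two_terminal_graph :: "'a pair_pre_digraph \<Rightarrow> 'a \<Rightarrow> 'a \<Rightarrow> bool" where
  "two_terminal_graph G u v \<longleftrightarrow>
     pair_graph G \<and> u \<in> pverts G \<and> v \<in> pverts G \<and> u \<noteq> v \<and> (u, v) \<notin> parcs G"

definition uv_separator :: "'a pair_pre_digraph \<Rightarrow> 'a \<Rightarrow> 'a \<Rightarrow> 'a set \<Rightarrow> bool" where
  "uv_separator G u v S \<longleftrightarrow>
     S \<subseteq> pverts G - {u, v} \<and>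
     (\<exists>C \<in> pre_digraph.sccs_verts (with_proj G \<restriction> (pverts G - S)).
      \<exists>D \<in> pre_digraph.sccs_verts (with_proj G \<restriction> (pverts G - S)).
        u \<in> C \<and> v \<in> D \<and> C \<noteq> D)"

definition minimal_uv_separator :: "'a pair_pre_digraph \<Rightarrow> 'a \<Rightarrow> 'a \<Rightarrow> 'a set \<Rightarrow> bool" where
  "minimal_uv_separator G u v S \<longleftrightarrow>
     uv_separator G u v S \<and> (\<forall>T. T \<subset> S \<longrightarrow> \<not> uv_separator G u v T)"


section \<open>Reconfiguration\<close>

definition tj_adjacent :: "'a set \<Rightarrow> 'a set \<Rightarrow> bool" where
  "tj_adjacent S S' \<longleftrightarrow> card S = card S' \<and> card (S - S') = 1 \<and> card (S' - S) = 1"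

definition tar_adjacent :: "nat \<Rightarrow> 'a set \<Rightarrow> 'a set \<Rightarrow> bool" where
  "tar_adjacent k S S' \<longleftrightarrow>
     card ((S - S') \<union> (S' - S)) = 1 \<and> max (card S) (card S') \<le> k"

definition reconf_seqs ::
  "('a set \<Rightarrow> 'a set \<Rightarrow> bool) \<Rightarrow> 'a pair_pre_digraph \<Rightarrow> 'a \<Rightarrow> 'a \<Rightarrow> 'a set \<Rightarrow> 'a set \<Rightarrow> 'a set list set"
where
  "reconf_seqs adj G u v Sa Sb =
     {Ss. Ss \<noteq> [] \<and> hd Ss = Sa \<and> last Ss = Sb \<and>
          (\<forall>S \<in> set Ss. uv_separator G u v S) \<and> successively adj Ss}"

definition reconfigurable ::
  "('a set \<Rightarrow> 'a set \<Rightarrow> bool) \<Rightarrow> 'a pair_pre_digraph \<Rightarrow> 'a \<Rightarrow> 'a \<Rightarrow> 'a set \<Rightarrow> 'a set \<Rightarrow> bool"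
where
  "reconfigurable adj G u v Sa Sb \<longleftrightarrow> reconf_seqs adj G u v Sa Sb \<noteq> {}"

text \<open>The distance is \<open>\<infinity>\<close> if there is no reconfiguration sequence.\<close>

definition reconf_dist ::
  "('a set \<Rightarrow> 'a set \<Rightarrow> bool) \<Rightarrow> 'a pair_pre_digraph \<Rightarrow> 'a \<Rightarrow> 'a \<Rightarrow> 'a set \<Rightarrow> 'a set \<Rightarrow> enat"
where
  "reconf_dist adj G u v Sa Sb = (INF Ss \<in> reconf_seqs adj G u v Sa Sb. enat (length Ss - 1))"

abbreviation TJ :: "'a pair_pre_digraph \<Rightarrow> 'a \<Rightarrow> 'a \<Rightarrow> 'a set \<Rightarrow> 'a set \<Rightarrow> bool" where
  "TJ \<equiv> reconfigurable tj_adjacent"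

abbreviation TAR :: "nat \<Rightarrow> 'a pair_pre_digraph \<Rightarrow> 'a \<Rightarrow> 'a \<Rightarrow> 'a set \<Rightarrow> 'a set \<Rightarrow> bool" where
  "TAR k \<equiv> reconfigurable (tar_adjacent k)"

abbreviation dist_TJ :: "'a pair_pre_digraph \<Rightarrow> 'a \<Rightarrow> 'a \<Rightarrow> 'a set \<Rightarrow> 'a set \<Rightarrow> enat" where
  "dist_TJ \<equiv> reconf_dist tj_adjacent"

abbreviation dist_TAR :: "nat \<Rightarrow> 'a pair_pre_digraph \<Rightarrow> 'a \<Rightarrow> 'a \<Rightarrow> 'a set \<Rightarrow> 'a set \<Rightarrow> enat" where
  "dist_TAR k \<equiv> reconf_dist (tar_adjacent k)"


section \<open>Random access machines\<close>

text \<open>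
  Running times are measured on the unit-cost random access machine with addition and truncated
  subtraction. Programs are while-programs over finitely many named memory banks, each
  of which is an array of natural numbers indexed by the natural numbers; a scalar variable is cell
  \<open>0\<close> of a bank. Expressions may be nested, but every command and every evaluation of a guard
  is charged one step: the size of the expressions is bounded by a constant
  that depends on the program only, so this affects the running time by a constant factor.
\<close>

type_synonym store = "string \<Rightarrow> nat \<Rightarrow> nat"

datatype ram_exp =
    Const nat
  | Cell string ram_exp
  | Plus ram_exp ram_exp
  | Monus ram_exp ram_exp

fun ram_eval :: "ram_exp \<Rightarrow> store \<Rightarrow> nat" where
  "ram_eval (Const n) s = n"
| "ram_eval (Cell x a) s = s x (ram_eval a s)"
| "ram_eval (Plus a b) s = ram_eval a s + ram_eval b s"
| "ram_eval (Monus a b) s = ram_eval a s - ram_eval b s"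

datatype ram_prog =
    Skip
  | Assign string ram_exp ram_exp
  | Seq ram_prog ram_prog
  | Cond ram_exp ram_prog ram_prog
  | While ram_exp ram_prog

text \<open>
  \<open>ram_exec p s t s'\<close>: started in \<open>s\<close>, the program \<open>p\<close> halts in \<open>s'\<close> after \<open>t\<close> steps. The command
  \<open>Assign x a b\<close> is \<open>x[a] := b\<close>, and a guard holds if its value is not \<open>0\<close>.
\<close>

inductive ram_exec :: "ram_prog \<Rightarrow> store \<Rightarrow> nat \<Rightarrow> store \<Rightarrow> bool" where
  Skip: "ram_exec Skip s 1 s"
| Assign: "ram_exec (Assign x a b) s 1 (s(x := (s x)(ram_eval a s := ram_eval b s)))"
| Seq: "ram_exec p s t s' \<Longrightarrow> ram_exec q s' t' s'' \<Longrightarrow> ram_exec (Seq p q) s (t + t') s''"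
| CondTrue: "ram_eval g s \<noteq> 0 \<Longrightarrow> ram_exec p s t s' \<Longrightarrow> ram_exec (Cond g p q) s (1 + t) s'"
| CondFalse: "ram_eval g s = 0 \<Longrightarrow> ram_exec q s t s' \<Longrightarrow> ram_exec (Cond g p q) s (1 + t) s'"
| WhileFalse: "ram_eval g s = 0 \<Longrightarrow> ram_exec (While g p) s 1 s"
| WhileTrue: "ram_eval g s \<noteq> 0 \<Longrightarrow> ram_exec p s t s' \<Longrightarrow> ram_exec (While g p) s' t' s'' \<Longrightarrow>
    ram_exec (While g p) s (1 + t + t') s''"

definition input_store :: "nat list \<Rightarrow> store" where
  "input_store w = (\<lambda>x i.
     if x = ''in'' \<and> i < length w then w ! i
     else if x = ''inlen'' \<and> i = 0 then length w
     else 0)"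

definition output_word :: "store \<Rightarrow> nat list" where
  "output_word s = map (s ''out'') [0..<s ''outlen'' 0]"

definition ram_computes :: "ram_prog \<Rightarrow> nat list \<Rightarrow> nat \<Rightarrow> nat list \<Rightarrow> bool" where
  "ram_computes p w t w' \<longleftrightarrow> (\<exists>s. ram_exec p (input_store w) t s \<and> output_word s = w')"


section \<open>Encoding of instances\<close>

text \<open>
  The vertices are numbered \<open>0, \<dots>, n - 1\<close> by \<open>f\<close>. A graph is given by the list of its vertices
  and the list of its edges, each edge in one of its two orientations; the length of such a word
  is \<open>n + 2 m + 2\<close>. Orders and orientations are arbitrary, so that an instance has
  several encodings.
\<close>

definition enc_set :: "('a \<Rightarrow> nat) \<Rightarrow> 'a set \<Rightarrow> nat list \<Rightarrow> bool" where
  "enc_set f S w \<longleftrightarrow> (\<exists>xs. distinct xs \<and> set xs = S \<and> w = length xs # map f xs)"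

definition enc_edges :: "('a \<Rightarrow> nat) \<Rightarrow> ('a \<times> 'a) set \<Rightarrow> nat list \<Rightarrow> bool" where
  "enc_edges f A w \<longleftrightarrow>
     (\<exists>es. distinct es \<and> set es \<union> (set es)\<inverse> = A \<and> set es \<inter> (set es)\<inverse> = {} \<and>
           w = length es # concat (map (\<lambda>(x, y). [f x, f y]) es))"

definition enc_graph :: "('a \<Rightarrow> nat) \<Rightarrow> 'a pair_pre_digraph \<Rightarrow> nat list \<Rightarrow> bool" where
  "enc_graph f G w \<longleftrightarrow>
     bij_betw f (pverts G) {..<card (pverts G)} \<and>
     (\<exists>w1 w2. enc_set f (pverts G) w1 \<and> enc_edges f (parcs G) w2 \<and> w = w1 @ w2)"

definition enc_TJ ::
  "('a \<Rightarrow> nat) \<Rightarrow> 'a pair_pre_digraph \<Rightarrow> 'a \<Rightarrow> 'a \<Rightarrow> 'a set \<Rightarrow> 'a set \<Rightarrow> nat list \<Rightarrow> bool"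
where
  "enc_TJ f G u v Sa Sb w \<longleftrightarrow>
     (\<exists>g a b. enc_graph f G g \<and> enc_set f Sa a \<and> enc_set f Sb b \<and>
              w = g @ [f u, f v] @ a @ b)"

definition enc_TAR ::
  "('a \<Rightarrow> nat) \<Rightarrow> nat \<Rightarrow> 'a pair_pre_digraph \<Rightarrow> 'a \<Rightarrow> 'a \<Rightarrow> 'a set \<Rightarrow> 'a set \<Rightarrow> nat list \<Rightarrow> bool"
where
  "enc_TAR f k G u v Sa Sb w \<longleftrightarrow>
     (\<exists>g a b. enc_graph f G g \<and> enc_set f Sa a \<and> enc_set f Sb b \<and>
              w = g @ [f u, f v] @ a @ b @ [k])"

inductive_cases ram_SkipE: "ram_exec Skip s t s'"
inductive_cases ram_AssignE: "ram_exec (Assign x a b) s t s'"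
inductive_cases ram_SeqE: "ram_exec (Seq p q) s t s'"
inductive_cases ram_CondE: "ram_exec (Cond g p q) s t s'"
inductive_cases ram_WhileE: "ram_exec (While g p) s t s'"

lemma ram_exec_deterministic:
  "ram_exec p s t s' \<Longrightarrow> ram_exec p s t2 s2 \<Longrightarrow> t2 = t \<and> s2 = s'"
proof (induction arbitrary: t2 s2 rule: ram_exec.induct)
  case (Seq p s t s' q t' s'')
  from Seq.prems show ?case by (rule ram_SeqE) (use Seq.IH in blast)
next
  case (CondTrue g s p t s' q)
  from CondTrue.prems show ?case
    by (rule ram_CondE) (use CondTrue.hyps(1) CondTrue.IH in force)+
next
  case (CondFalse g s q t s' p)
  from CondFalse.prems show ?case
    by (rule ram_CondE) (use CondFalse.hyps(1) CondFalse.IH in force)+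
next
  case (WhileFalse g s p)
  from WhileFalse.prems show ?case by (rule ram_WhileE) (use WhileFalse.hyps in simp_all)
next
  case (WhileTrue g s p t s' t' s'')
  from WhileTrue.prems show ?case
  proof (rule ram_WhileE)
    fix a s1 b
    assume *: "t2 = Suc (a + b)" "ram_exec p s a s1" "ram_exec (While g p) s1 b s2"
    from WhileTrue.IH(1)[OF *(2)] have "a = t" "s1 = s'" by auto
    moreover from WhileTrue.IH(2)[of b s2] *(3) \<open>s1 = s'\<close> have "b = t'" "s2 = s''" by auto
    ultimately show ?thesis using *(1) by simp
  qed (use WhileTrue.hyps(1) in simp)
qed (simp_all add: ram_exec.simps[of Skip] ram_exec.simps[of "Assign _ _ _"])

lemma orientation_exists:
  assumes "finite A" "sym A" "irrefl A"
  shows "\<exists>E. finite E \<and> E \<union> E\<inverse> = A \<and> E \<inter> E\<inverse> = {}"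
proof -
  have fin: "finite (Field A)" using assms(1) by (rule finite_Field)
  obtain h :: "'a \<Rightarrow> nat" where h: "inj_on h (Field A)"
    using finite_imp_inj_to_nat_seg[OF fin] by blast
  define E where "E = {(x, y) \<in> A. h x < h y}"
  have "h x \<noteq> h y" if "(x, y) \<in> A" for x y
    using that h assms(3) by (auto simp: inj_on_def irrefl_def Field_def)
  then have "E \<union> E\<inverse> = A" "E \<inter> E\<inverse> = {}"
    using assms(2) by (auto simp: E_def sym_def neq_iff)
  moreover have "finite E" using assms(1) by (rule finite_subset[rotated]) (auto simp: E_def)
  ultimately show ?thesis by blast
qed

lemma encodings_exist:
  assumes "two_terminal_graph G u v" "uv_separator G u v Sa" "uv_separator G u v Sb"
  shows "\<exists>f w. enc_TJ f G u v Sa Sb w" and "\<exists>f w. enc_TAR f k G u v Sa Sb w"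
proof -
  interpret pair_graph G using assms(1) by (simp add: two_terminal_graph_def)
  have fV: "finite (pverts G)" and fA: "finite (parcs G)"
    by (rule pair_finite_verts, rule pair_finite_arcs)
  obtain f where f: "bij_betw f (pverts G) {..<card (pverts G)}"
    using ex_bij_betw_finite_nat[OF fV] by (auto simp: atLeast0LessThan)
  have set: "\<exists>w. enc_set f S w" if "finite S" for S
    using finite_distinct_list[OF that] by (auto simp: enc_set_def)
  have "sym (parcs G)" using pair_sym_arcs by (simp add: symmetric_def)
  moreover have "irrefl (parcs G)" using pair_no_loops by (force simp: irrefl_def)
  ultimately obtain E where "finite E" "E \<union> E\<inverse> = parcs G" "E \<inter> E\<inverse> = {}"
    using orientation_exists[OF fA] by blast
  then have "\<exists>w. enc_edges f (parcs G) w"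
    using finite_distinct_list[of E] by (auto simp: enc_edges_def)
  with set[OF fV] f have g: "\<exists>w. enc_graph f G w" by (auto simp: enc_graph_def)
  have "finite Sa" "finite Sb"
    using assms(2,3) fV by (auto simp: uv_separator_def intro: finite_subset)
  then obtain g a b where "enc_graph f G g" "enc_set f Sa a" "enc_set f Sb b"
    using set g by meson
  then have "enc_TJ f G u v Sa Sb (g @ [f u, f v] @ a @ b)"
    and "enc_TAR f k G u v Sa Sb (g @ [f u, f v] @ a @ b @ [k])"
    unfolding enc_TJ_def enc_TAR_def by blast+
  then show "\<exists>f w. enc_TJ f G u v Sa Sb w" "\<exists>f w. enc_TAR f k G u v Sa Sb w"
    by blast+
qed

end

theory Submission
  imports Defs
begin

text \<open>
  A jump is an addition followed by a removal, which gives one half of (i). Conversely, let a TAR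
  sequence with bound \<open>k + 1\<close> join two separators of size \<open>k\<close>. Supersets of separators that avoid the
  terminals are separators, so the current set can be accompanied by a separator of size \<open>k\<close> that
  contains it, and this companion has to jump at most once for every addition; additions make
  up half of the sequence. For (ii), the last step into a minimal separator of size \<open>k\<close> would come
  from a smaller separator or from a set of size \<open>k + 1\<close>.

  For (iii), each of the two separators is enlarged until it has \<open>k\<close> vertices or contains all
  non-terminals, and then one vertex is dropped from a set of size \<open>k\<close> if the rest still separates.
  These are TAR moves, so the answer does not change. The results have size \<open>k - 1\<close>, where (i) applies,
  unless all non-terminals are fewer than \<open>k\<close> or the two given sets are one minimal separator of
  size \<open>k\<close>; in both exceptional cases the two results coincide. Whether a set separates is
  decided by \<open>n\<close> rounds of relaxing all edges: a round without progress leaves a set that is closed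
  under adjacency, and there can be no more than \<open>n\<close> rounds with progress.
\<close>

section \<open>Sequences and minima\<close>

text \<open>Trades lists for powers of a relation, where step counts are exponents and can be added.
  \<open>P\<close> is built into both ends of the relation, so that a power remembers that the sets
  it passes are separators.\<close>

lemma successively_relpowp:
  "Ss \<noteq> [] \<Longrightarrow> successively R Ss \<Longrightarrow> (\<forall>S\<in>set Ss. P S) \<Longrightarrow>
    ((\<lambda>S S'. P S \<and> P S' \<and> R S S') ^^ (length Ss - 1)) (hd Ss) (last Ss)"
proof (induction Ss rule: induct_list012)
  case (3 x y zs)
  have "((\<lambda>S S'. P S \<and> P S' \<and> R S S') ^^ (length (y # zs) - 1)) (hd (y # zs)) (last (y # zs))"
    using 3 by (intro "3.IH"(2)) auto
  moreover have "P x \<and> P y \<and> R x y" using 3 by auto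
  ultimately have "((\<lambda>S S'. P S \<and> P S' \<and> R S S') ^^ Suc (length (y # zs) - 1)) x (last (y # zs))"
    by (intro relpowp_Suc_I2[of _ x y]) auto
  then show ?case by simp
qed auto

text \<open>The converse passage. \<open>P A\<close> is assumed because the power 0 says nothing
  about \<open>A\<close>.\<close>

lemma relpowp_successively:
  "((\<lambda>S S'. P S \<and> P S' \<and> R S S') ^^ n) A B \<Longrightarrow> P A \<Longrightarrow>
    \<exists>Ss. Ss \<noteq> [] \<and> hd Ss = A \<and> last Ss = B \<and> (\<forall>S\<in>set Ss. P S) \<and> successively R Ss \<and>
      length Ss - 1 = n"
proof (induction n arbitrary: A)
  case 0
  then show ?case by (intro exI[of _ "[A]"]) auto
next
  case (Suc n)
  obtain C where C: "P C" "R A C" "((\<lambda>S S'. P S \<and> P S' \<and> R S S') ^^ n) C B"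
    using relpowp_Suc_D2[OF Suc.prems(1)] by blast
  from Suc.IH[OF C(3,1)] obtain Ss where "Ss \<noteq> []" "hd Ss = C" "last Ss = B"
    "\<forall>S\<in>set Ss. P S" "successively R Ss" "length Ss - 1 = n" by blast
  then show ?case using C Suc.prems(2)
    by (intro exI[of _ "A # Ss"]) (auto simp: successively_Cons)
qed

text \<open>The two minimisers bound each other. \<open>QP\<close> is an inequality because a TAR
  sequence may yield fewer jumps than half the number of its steps.\<close>

lemma Least_double:
  fixes P Q :: "nat \<Rightarrow> bool"
  assumes "P n" and PQ: "\<And>n. P n \<Longrightarrow> Q (2 * n)" and QP: "\<And>m. Q m \<Longrightarrow> \<exists>n. P n \<and> 2 * n \<le> m"
  shows "(LEAST m. Q m) = 2 * (LEAST n. P n)"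
proof (rule antisym)
  show "(LEAST m. Q m) \<le> 2 * (LEAST n. P n)"
    by (rule Least_le) (use PQ LeastI[of P, OF assms(1)] in blast)
  have "Q (LEAST m. Q m)" using PQ[OF assms(1)] by (rule LeastI)
  then obtain n' where "P n'" "2 * n' \<le> (LEAST m. Q m)" using QP by blast
  moreover have "(LEAST n. P n) \<le> n'" using \<open>P n'\<close> by (rule Least_le)
  ultimately show "2 * (LEAST n. P n) \<le> (LEAST m. Q m)" by linarith
qed

text \<open>The infimum is attained, which turns finite distances into least natural
  numbers.\<close>

lemma INF_enat_eq_Least:
  fixes P :: "nat \<Rightarrow> bool"
  assumes "P n"
  shows "(INF n \<in> Collect P. enat n) = enat (LEAST n. P n)"
proof (rule antisym)
  show "(INF n \<in> Collect P. enat n) \<le> enat (LEAST n. P n)"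
    by (rule INF_lower) (use LeastI[of P, OF assms] in simp)
  show "enat (LEAST n. P n) \<le> (INF n \<in> Collect P. enat n)"
    by (rule INF_greatest) (simp add: Least_le)
qed

section \<open>Separators\<close>

locale two_terminals =
  fixes G :: "'a pair_pre_digraph" and u v :: 'a
  assumes two_terminal_graph: "two_terminal_graph G u v"
begin

definition inner :: "'a set" where
  "inner = pverts G - {u, v}"

definition arcs_avoiding :: "'a set \<Rightarrow> ('a \<times> 'a) set" where
  "arcs_avoiding S = {(x, y) \<in> parcs G. x \<notin> S \<and> y \<notin> S}"

text \<open>By symmetry the component of \<open>u\<close> consists of all that \<open>u\<close>
  reaches, so lying in different components amounts to non-reachability. From here on the transitive
  closure of a plain relation replaces the induced subgraph.\<close>

lemma separator_iff: "uv_separator G u v S \<longleftrightarrow> S \<subseteq> inner \<and> (u, v) \<notin> (arcs_avoiding S)\<^sup>*"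
proof (cases "S \<subseteq> inner")
  case True
  interpret pair_graph G using two_terminal_graph by (simp add: two_terminal_graph_def)
  let ?H = "with_proj G \<restriction> (pverts G - S)"
  have ind: "induced_subgraph ?H (with_proj G)" by (rule induced_induce) simp
  interpret H: wf_digraph ?H by (rule wf_digraphI_induced[OF ind])
  have sym: "symmetric ?H"
    by (rule induced_graph_imp_symmetric[OF _ ind]) (rule pair_sym_arcs)
  \<comment> \<open>Arcs of \<open>G\<close> have their ends in \<open>pverts G\<close>, so
    restricting to \<open>pverts G - S\<close> is the same as avoiding \<open>S\<close>.\<close>
  have ends: "arcs_ends ?H = arcs_avoiding S"
    using in_arcsD1 in_arcsD2
    by (auto simp: arcs_ends_conv arcs_avoiding_def)
  have mem: "u \<in> verts ?H" "v \<in> verts ?H"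
    using True two_terminal_graph by (auto simp: two_terminal_graph_def inner_def)
  have reach: "u \<rightarrow>\<^sup>*\<^bsub>?H\<^esub> v \<longleftrightarrow> (u, v) \<in> (arcs_avoiding S)\<^sup>*"
  proof
    show "u \<rightarrow>\<^sup>*\<^bsub>?H\<^esub> v \<Longrightarrow> (u, v) \<in> (arcs_avoiding S)\<^sup>*"
      using reachable_rtranclI[of ?H u v] by (simp only: ends)
  next
    assume "(u, v) \<in> (arcs_avoiding S)\<^sup>*"
    then show "u \<rightarrow>\<^sup>*\<^bsub>?H\<^esub> v"
    proof induction
      case base
      show ?case using mem(1) by (simp add: H.reachable_refl)
    next
      case (step y z)
      then show ?case using H.reachable_adj_trans[of u y z] by (simp only: ends)
    qed
  qed
  have "(\<exists>C \<in> H.sccs_verts. \<exists>D \<in> H.sccs_verts. u \<in> C \<and> v \<in> D \<and> C \<noteq> D) \<longleftrightarrow> \<not> u \<rightarrow>\<^sup>*\<^bsub>?H\<^esub> v"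
  proof
    assume "\<exists>C \<in> H.sccs_verts. \<exists>D \<in> H.sccs_verts. u \<in> C \<and> v \<in> D \<and> C \<noteq> D"
    then obtain C D where CD: "C \<in> H.sccs_verts" "D \<in> H.sccs_verts" "u \<in> C" "v \<in> D" "C \<noteq> D"
      by blast
    then have "v \<notin> C" using H.sccs_verts_disjoint by blast
    then show "\<not> u \<rightarrow>\<^sup>*\<^bsub>?H\<^esub> v"
      using CD(1,3) symmetric_reachable[OF sym] unfolding H.in_sccs_verts_conv_reachable by blast
  next
    assume not: "\<not> u \<rightarrow>\<^sup>*\<^bsub>?H\<^esub> v"
    have "H.scc_of u \<in> H.sccs_verts" "H.scc_of v \<in> H.sccs_verts"
      using mem by (auto intro: H.scc_of_in_sccs_verts)
    moreover have "u \<in> H.scc_of u" "v \<in> H.scc_of v"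
      using mem by (auto intro: H.in_scc_of_self)
    moreover have "v \<notin> H.scc_of u" using not by (simp add: H.scc_of_def)
    ultimately show "\<exists>C \<in> H.sccs_verts. \<exists>D \<in> H.sccs_verts. u \<in> C \<and> v \<in> D \<and> C \<noteq> D" by blast
  qed
  then show ?thesis using True reach by (simp add: uv_separator_def inner_def)
qed (simp add: uv_separator_def inner_def)

lemma finite_inner: "finite inner"
  using two_terminal_graph pair_fin_digraph.pair_finite_verts pair_digraph.axioms(1) pair_graph.axioms(1)
  by (auto simp: two_terminal_graph_def inner_def)

lemma separator_inner: "uv_separator G u v S \<Longrightarrow> S \<subseteq> inner"
  by (simp add: separator_iff)

lemma finite_separator: "uv_separator G u v S \<Longrightarrow> finite S"
  using separator_inner finite_inner finite_subset by blast

text \<open>Deleting more vertices leaves fewer arcs and hence fewer walks. The condition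
  \<open>T \<subseteq> inner\<close> keeps the terminals in the graph.\<close>

lemma separator_mono:
  assumes "uv_separator G u v S" "S \<subseteq> T" "T \<subseteq> inner"
  shows "uv_separator G u v T"
proof -
  have "(arcs_avoiding T)\<^sup>* \<subseteq> (arcs_avoiding S)\<^sup>*"
    by (rule rtrancl_mono) (use assms(2) in \<open>auto simp: arcs_avoiding_def\<close>)
  then show ?thesis using assms by (auto simp: separator_iff)
qed

text \<open>By monotonicity a separating proper subset can be enlarged until it misses one vertex
  only, so deleting single vertices decides minimality. This is the form that a program can
  test.\<close>

lemma minimal_separator_iff:
  "minimal_uv_separator G u v S \<longleftrightarrow>
     uv_separator G u v S \<and> (\<forall>x\<in>S. \<not> uv_separator G u v (S - {x}))"
proof (intro iffI conjI)
  show "minimal_uv_separator G u v S \<Longrightarrow> uv_separator G u v S"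
    and "minimal_uv_separator G u v S \<Longrightarrow> \<forall>x\<in>S. \<not> uv_separator G u v (S - {x})"
    by (auto simp: minimal_uv_separator_def)
next
  assume *: "uv_separator G u v S \<and> (\<forall>x\<in>S. \<not> uv_separator G u v (S - {x}))"
  have "\<not> uv_separator G u v T" if T: "T \<subset> S" for T
  proof
    assume "uv_separator G u v T"
    moreover from T obtain x where "x \<in> S" "T \<subseteq> S - {x}" by blast
    ultimately have "uv_separator G u v (S - {x})"
      using separator_mono[of T "S - {x}"] separator_inner[of S] * by blast
    then show False using * \<open>x \<in> S\<close> by blast
  qed
  then show "minimal_uv_separator G u v S" using * by (simp add: minimal_uv_separator_def)
qed


section \<open>Reconfiguration steps\<close>

definition step :: "('a set \<Rightarrow> 'a set \<Rightarrow> bool) \<Rightarrow> 'a set \<Rightarrow> 'a set \<Rightarrow> bool" where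
  "step adj S S' \<longleftrightarrow> uv_separator G u v S \<and> uv_separator G u v S' \<and> adj S S'"

text \<open>All later arguments are about powers of \<open>step\<close>. \<open>A\<close> is assumed
  to be a separator for the sake of the one-element sequence, which contains no step.\<close>

lemma reconf_seqs_lengths:
  assumes "uv_separator G u v A"
  shows "(\<lambda>Ss. length Ss - 1) ` reconf_seqs adj G u v A B = {n. (step adj ^^ n) A B}"
proof -
  have eq: "step adj = (\<lambda>S S'. uv_separator G u v S \<and> uv_separator G u v S' \<and> adj S S')"
    by (intro ext) (simp add: step_def)
  show ?thesis
  proof (intro equalityI subsetI)
    fix n assume "n \<in> (\<lambda>Ss. length Ss - 1) ` reconf_seqs adj G u v A B"
    then show "n \<in> {n. (step adj ^^ n) A B}"
      using successively_relpowp[of _ adj "uv_separator G u v"] unfolding eq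
      by (auto simp: reconf_seqs_def)
  next
    fix n assume "n \<in> {n. (step adj ^^ n) A B}"
    then obtain Ss where "Ss \<in> reconf_seqs adj G u v A B" "length Ss - 1 = n"
      using relpowp_successively[where P = "uv_separator G u v" and R = adj and n = n and A = A and B = B] assms
      unfolding eq reconf_seqs_def by blast
    then show "n \<in> (\<lambda>Ss. length Ss - 1) ` reconf_seqs adj G u v A B" by blast
  qed
qed

lemma reconfigurable_iff:
  assumes "uv_separator G u v A"
  shows "reconfigurable adj G u v A B \<longleftrightarrow> (step adj)\<^sup>*\<^sup>* A B"
proof -
  have "reconfigurable adj G u v A B \<longleftrightarrow> {n. (step adj ^^ n) A B} \<noteq> {}"
    unfolding reconfigurable_def reconf_seqs_lengths[OF assms, symmetric] by simp
  then show ?thesis by (simp add: rtranclp_power)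
qed

lemma reconf_dist_eq:
  assumes "uv_separator G u v A"
  shows "reconf_dist adj G u v A B = (INF n \<in> {n. (step adj ^^ n) A B}. enat n)"
  unfolding reconf_dist_def reconf_seqs_lengths[OF assms, symmetric] by (simp add: image_image)

lemma reconf_dist_self:
  assumes "uv_separator G u v A"
  shows "reconf_dist adj G u v A A = 0"
proof -
  have "(INF n \<in> {n. (step adj ^^ n) A A}. enat n) \<le> enat 0" by (rule INF_lower) simp
  then show ?thesis by (simp add: reconf_dist_eq[OF assms] zero_enat_def[symmetric])
qed

section \<open>Single additions and removals\<close>

text \<open>Exactly one vertex lies in the symmetric difference, and the side it lies on tells an
  addition from a removal. Each case keeps the bound for the larger set.\<close>

lemma step_tar_cases:
  assumes "step (tar_adjacent k) S S'"
  obtains (add) x where "x \<notin> S" "S' = insert x S" "card S' = Suc (card S)" "card S' \<le> k"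
    | (remove) x where "x \<in> S" "S' = S - {x}" "card S = Suc (card S')" "card S \<le> k"
proof -
  have fin: "finite S" "finite S'" using assms finite_separator by (auto simp: step_def)
  from assms obtain x where x: "(S - S') \<union> (S' - S) = {x}" and k: "card S \<le> k" "card S' \<le> k"
    by (auto simp: step_def tar_adjacent_def card_1_singleton_iff)
  show thesis
  proof (cases "x \<in> S")
    case True
    then have "S' = S - {x}" using x by blast
    then have "card S = Suc (card S')" using card_Suc_Diff1[OF fin(1) True] by (simp only:)
    then show thesis by (rule remove[OF True \<open>S' = S - {x}\<close> _ k(1)])
  next
    case False
    have "z \<in> S' \<longleftrightarrow> z \<in> insert x S" for z
      using False eqset_imp_iff[OF x, of z] eqset_imp_iff[OF x, of x] by auto
    then have "S' = insert x S" by blast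
    moreover have "card (insert x S) = Suc (card S)" using False fin(1) by simp
    ultimately show thesis using False k by (intro add) auto
  qed
qed

lemma step_tar_insert:
  assumes "uv_separator G u v S" "x \<in> inner" "x \<notin> S" "card S < k"
  shows "step (tar_adjacent k) S (insert x S)" and "step (tar_adjacent k) (insert x S) S"
proof -
  have "uv_separator G u v (insert x S)"
    by (rule separator_mono[OF assms(1)]) (use assms separator_inner in auto)
  moreover have "(S - insert x S) \<union> (insert x S - S) = {x}"
    "(insert x S - S) \<union> (S - insert x S) = {x}" using assms(3) by auto
  ultimately show "step (tar_adjacent k) S (insert x S)" "step (tar_adjacent k) (insert x S) S"
    using assms finite_separator[OF assms(1)] by (simp_all add: step_def tar_adjacent_def)
qed

lemma step_tar_sym: "step (tar_adjacent k) S S' \<Longrightarrow> step (tar_adjacent k) S' S"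
  by (auto simp: step_def tar_adjacent_def Un_commute)

lemma steps_tar_sym: "(step (tar_adjacent k))\<^sup>*\<^sup>* S S' \<Longrightarrow> (step (tar_adjacent k))\<^sup>*\<^sup>* S' S"
  by (induction rule: rtranclp_induct) (auto intro: converse_rtranclp_into_rtranclp step_tar_sym)

text \<open>The vertices of \<open>T - S\<close> are added one by one. Everything between
  \<open>S\<close> and \<open>T\<close> separates by monotonicity and has at most
  \<open>card T\<close> elements, so every addition is legal.\<close>

lemma steps_tar_superset:
  assumes "uv_separator G u v S" "S \<subseteq> T" "T \<subseteq> inner" "card T \<le> k"
  shows "(step (tar_adjacent k))\<^sup>*\<^sup>* S T"
proof -
  have "finite T" using assms(3) finite_inner finite_subset by blast
  then have "finite (T - S)" by simp
  then have "(step (tar_adjacent k))\<^sup>*\<^sup>* S (S \<union> X)" if "X \<subseteq> T - S" for X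
    using that
  proof (induction X rule: infinite_finite_induct)
    case (infinite X)
    then show ?case using finite_subset by blast
  next
    case (insert x X)
    \<comment> \<open>Measuring the set after the addition gives the strict bound that
      \<open>step_tar_insert\<close> demands before it.\<close>
    have "card (insert x (S \<union> X)) \<le> card T"
      using insert.prems assms(2) \<open>finite T\<close> by (intro card_mono) auto
    moreover have "finite (S \<union> X)"
      using insert.prems assms(2) \<open>finite T\<close> by (auto intro: finite_subset)
    ultimately have "card (S \<union> X) < k" using insert assms(4) by auto
    moreover have "uv_separator G u v (S \<union> X)"
      by (rule separator_mono[OF assms(1)]) (use insert.prems assms(2,3) in auto)
    ultimately have "step (tar_adjacent k) (S \<union> X) (insert x (S \<union> X))"
      using insert assms(3) by (intro step_tar_insert) auto
    then show ?case using insert by auto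
  qed simp
  from this[of "T - S"] show ?thesis using assms(2) by (simp add: Un_absorb1)
qed

section \<open>Token jumping versus token addition and removal\<close>

text \<open>The new token is placed before the old one is taken away, so the set in between contains
  a separator and is one itself; its size \<open>k + 1\<close> explains the bound.\<close>

lemma tj_step_imp_tar_steps:
  assumes "step tj_adjacent S S'" "card S = k"
  shows "(step (tar_adjacent (k + 1)) ^^ 2) S S'"
proof -
  have sep: "uv_separator G u v S" "uv_separator G u v S'" using assms by (auto simp: step_def)
  from assms obtain x y where xy: "S - S' = {x}" "S' - S = {y}" and card: "card S' = card S"
    by (auto simp: step_def tj_adjacent_def card_1_singleton_iff)
  have eq: "insert x S' = insert y S" using xy by blast
  have "step (tar_adjacent (k + 1)) S (insert y S)"
    using xy sep separator_inner assms(2) by (intro step_tar_insert) auto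
  moreover have "step (tar_adjacent (k + 1)) (insert x S') S'"
    using xy sep separator_inner assms(2) card by (intro step_tar_insert) auto
  ultimately show ?thesis unfolding eq by (auto simp: numeral_2_eq_2)
qed

lemma card_tj_steps: "(step tj_adjacent ^^ n) S S' \<Longrightarrow> card S' = card S"
  by (induction n arbitrary: S') (auto simp: step_def tj_adjacent_def)

lemma tj_steps_imp_tar_steps:
  "(step tj_adjacent ^^ n) S S' \<Longrightarrow> card S = k \<Longrightarrow> (step (tar_adjacent (k + 1)) ^^ (2 * n)) S S'"
proof (induction n arbitrary: S')
  case (Suc n)
  from Suc.prems(1) obtain T where T: "(step tj_adjacent ^^ n) S T" "step tj_adjacent T S'" by auto
  have "(step (tar_adjacent (k + 1)) ^^ (2 * n)) S T" using Suc T by blast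
  moreover have "(step (tar_adjacent (k + 1)) ^^ 2) T S'"
    using T Suc.prems(2) card_tj_steps by (intro tj_step_imp_tar_steps) auto
  ultimately have "(step (tar_adjacent (k + 1)) ^^ (2 * n + 2)) S S'"
    unfolding relpowp_add by blast
  then show ?case by (simp add: mult_2 numeral_2_eq_2)
qed simp

text \<open>
  A shadow \<open>T\<close> of size \<open>k\<close> follows the current set \<open>S\<close> of a TAR sequence: \<open>T\<close> contains \<open>S\<close> as long
  as \<open>S\<close> has at most \<open>k\<close> elements, and jumps are only paid for by additions. Of the \<open>m\<close> steps made
  so far, \<open>a\<close> are additions, that is \<open>2 a = m + |S| - k\<close>.
\<close>

lemma tar_steps_shadow:
  assumes "(step (tar_adjacent (k + 1)) ^^ m) A S" "uv_separator G u v A" "card A = k"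
  shows "\<exists>T d a. (step tj_adjacent ^^ d) A T \<and> uv_separator G u v T \<and> card T = k \<and>
    2 * a + k = m + card S \<and> uv_separator G u v S \<and>
    (card S \<le> k \<and> S \<subseteq> T \<and> d \<le> a \<or> card S = k + 1 \<and> T \<subseteq> S \<and> d + 1 \<le> a)"
  using assms(1)
proof (induction m arbitrary: S)
  case 0
  then show ?case using assms by - (rule exI[of _ A], rule exI[of _ 0], rule exI[of _ 0], auto)
next
  case (Suc m)
  from Suc.prems obtain S0 where S0: "(step (tar_adjacent (k + 1)) ^^ m) A S0"
    and st: "step (tar_adjacent (k + 1)) S0 S" by auto
  from Suc.IH[OF S0] obtain T d a where T: "(step tj_adjacent ^^ d) A T" "uv_separator G u v T"
      "card T = k" and a: "2 * a + k = m + card S0"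
    and sh: "card S0 \<le> k \<and> S0 \<subseteq> T \<and> d \<le> a \<or> card S0 = k + 1 \<and> T \<subseteq> S0 \<and> d + 1 \<le> a"
    by blast
  have sep: "uv_separator G u v S0" "uv_separator G u v S" using st by (auto simp: step_def)
  note fin = finite_separator[OF sep(1)] finite_separator[OF sep(2)] finite_separator[OF T(2)]
  have jump: "(step tj_adjacent ^^ Suc d) A T'"
    if "uv_separator G u v T'" "tj_adjacent T T'" for T'
    using T that by (auto simp: step_def)
  from st show ?case
  proof (cases rule: step_tar_cases)
    case (add x)
    have a': "2 * (a + 1) + k = Suc m + card S" using a add by simp
    from sh add have small: "card S0 \<le> k" "S0 \<subseteq> T" "d \<le> a" by auto
    consider "card S0 = k" | "card S0 < k" "x \<in> T" | "card S0 < k" "x \<notin> T"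
      using small(1) by linarith
    then show ?thesis
    proof cases
      case 1
      \<comment> \<open>A set of size \<open>k\<close> coincides with its shadow. The shadow stays
        put, and the addition just made is the credit recorded by
        \<open>d + 1 \<le> a\<close>.\<close>
      then have "S0 = T" using small(2) T(3) fin by (simp add: card_subset_eq)
      then show ?thesis using T a' sep add 1 small
        by - (rule exI[of _ T], rule exI[of _ d], rule exI[of _ "a + 1"], auto)
    next
      case 2
      then show ?thesis using T a' sep add small
        by - (rule exI[of _ T], rule exI[of _ d], rule exI[of _ "a + 1"], auto)
    next
      case 3
      \<comment> \<open>The current set is smaller than the shadow, so some token \<open>y\<close>
        of the shadow lies outside it. That token jumps to \<open>x\<close>, and the addition of
        \<open>x\<close> pays for the jump.\<close>
      then have "S0 \<subset> T" using T(3) small(2) by auto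
      then obtain y where y: "y \<in> T" "y \<notin> S0" by blast
      define T' where "T' = insert x (T - {y})"
      have sub: "S \<subseteq> T'" using add small(2) y by (auto simp: T'_def)
      have sepT': "uv_separator G u v T'"
        by (rule separator_mono[OF sep(2) sub])
          (use separator_inner[OF T(2)] separator_inner[OF sep(2)] add in \<open>auto simp: T'_def\<close>)
      have "T - T' = {y}" "T' - T = {x}" using 3 y by (auto simp: T'_def)
      moreover have cT': "card T' = card T"
        using 3 y fin card_Suc_Diff1[OF fin(3) y(1)] by (simp add: T'_def)
      ultimately have "tj_adjacent T T'" by (simp add: tj_adjacent_def)
      from jump[OF sepT' this] show ?thesis
        using sub sepT' cT' T(3) a' sep(2) add 3 small
        by - (rule exI[of _ T'], rule exI[of _ "Suc d"], rule exI[of _ "a + 1"], auto)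
    qed
  next
    case (remove x)
    have a': "2 * a + k = Suc m + card S" using a remove(3) by simp
    have sub: "S \<subseteq> S0" using remove(2) by blast
    from sh show ?thesis
    proof (elim disjE conjE)
      assume *: "card S0 \<le> k" "S0 \<subseteq> T" "d \<le> a"
      have "card S \<le> k" "S \<subseteq> T" using * sub remove(3) by auto
      then show ?thesis using T a' sep(2) *(3)
        by - (rule exI[of _ T], rule exI[of _ d], rule exI[of _ a], auto)
    next
      assume big: "card S0 = k + 1" "T \<subseteq> S0" "d + 1 \<le> a"
      then have cS: "card S = k" using remove(3) by simp
      show ?thesis
      \<comment> \<open>At size \<open>k + 1\<close> the shadow misses one vertex of
        \<open>S0\<close>. Removing that vertex makes the two sets meet; removing any other makes
        the token on \<open>x\<close> jump to it, at the expense of the saved credit.\<close>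
      proof (cases "x \<in> T")
        case False
        then have "T \<subseteq> S" using big(2) remove(2) by blast
        then have "T = S" using T(3) cS fin(2) by (simp add: card_subset_eq)
        then show ?thesis using T a' sep(2) cS big(3)
          by - (rule exI[of _ T], rule exI[of _ d], rule exI[of _ a], auto)
      next
        case True
        have "card (S0 - T) = 1" using card_Diff_subset[OF fin(3) big(2)] big T(3) by simp
        moreover have "S - T = S0 - T" "T - S = {x}" using True remove(2) big(2) by auto
        ultimately have "tj_adjacent T S" using cS T(3) by (simp add: tj_adjacent_def)
        from jump[OF sep(2) this] show ?thesis using sep(2) cS a' big(3)
          by - (rule exI[of _ S], rule exI[of _ "Suc d"], rule exI[of _ a], auto)
      qed
    qed
  qed
qed

text \<open>At the end \<open>card B = k\<close>, so the shadow that contains \<open>B\<close>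
  equals \<open>B\<close>. The count of additions then reads \<open>2 * a = m\<close>, and there
  were at most \<open>a\<close> jumps.\<close>

lemma tar_steps_imp_tj_steps:
  assumes "(step (tar_adjacent (k + 1)) ^^ m) A B" "uv_separator G u v A" "card A = k" "card B = k"
  shows "\<exists>n. (step tj_adjacent ^^ n) A B \<and> 2 * n \<le> m"
proof -
  from tar_steps_shadow[OF assms(1-3)] assms(4) obtain T d a where
    T: "(step tj_adjacent ^^ d) A T" "card T = k" "uv_separator G u v T" "B \<subseteq> T" and
    a: "2 * a + k = m + k" "d \<le> a" by auto
  have "B = T" using T assms(4) finite_separator by (intro card_subset_eq) auto
  then show ?thesis using T(1) a by (intro exI[of _ d]) auto
qed

lemma TJ_iff_TAR:
  assumes "uv_separator G u v A" "card A = k" "card B = k"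
  shows "TJ G u v A B \<longleftrightarrow> TAR (k + 1) G u v A B"
proof -
  have "(\<exists>n. (step tj_adjacent ^^ n) A B) \<longleftrightarrow> (\<exists>n. (step (tar_adjacent (k + 1)) ^^ n) A B)"
  proof
    assume "\<exists>n. (step tj_adjacent ^^ n) A B"
    then show "\<exists>n. (step (tar_adjacent (k + 1)) ^^ n) A B"
      using tj_steps_imp_tar_steps assms(2) by blast
  next
    assume "\<exists>n. (step (tar_adjacent (k + 1)) ^^ n) A B"
    then show "\<exists>n. (step tj_adjacent ^^ n) A B" using tar_steps_imp_tj_steps assms by blast
  qed
  then show ?thesis by (simp only: reconfigurable_iff[OF assms(1)] rtranclp_power)
qed

text \<open>Jumps double to TAR steps and TAR steps halve to jumps, so the minima correspond. In the
  extended reals, half of the distance makes sense also when it is infinite.\<close>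

lemma dist_TJ_eq_half_dist_TAR:
  assumes "uv_separator G u v A" "card A = k" "card B = k"
  shows "ereal_of_enat (dist_TJ G u v A B) = ereal_of_enat (dist_TAR (k + 1) G u v A B) / 2"
proof -
  let ?P = "\<lambda>n. (step tj_adjacent ^^ n) A B" and ?Q = "\<lambda>n. (step (tar_adjacent (k + 1)) ^^ n) A B"
  have PQ: "\<And>n. ?P n \<Longrightarrow> ?Q (2 * n)" using tj_steps_imp_tar_steps assms(2) by blast
  have QP: "\<And>m. ?Q m \<Longrightarrow> \<exists>n. ?P n \<and> 2 * n \<le> m"
    using tar_steps_imp_tj_steps assms by blast
  show ?thesis
  proof (cases "\<exists>n. ?P n")
    case True
    then obtain n where n: "?P n" by blast
    show ?thesis
      unfolding reconf_dist_eq[OF assms(1)] INF_enat_eq_Least[of ?P, OF n]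
        INF_enat_eq_Least[of ?Q, OF PQ[OF n]]
      using Least_double[of ?P n ?Q, OF n PQ QP] by simp
  next
    case False
    \<comment> \<open>By \<open>QP\<close> there is then no TAR sequence either, and both infima
      range over the empty set.\<close>
    then have "Collect ?P = {}" "Collect ?Q = {}" using QP by auto
    then show ?thesis unfolding reconf_dist_eq[OF assms(1)] by (simp add: top_enat_def)
  qed
qed

lemma not_TAR_minimal_separator:
  assumes "uv_separator G u v A" "A \<noteq> B" "minimal_uv_separator G u v B" "card B = k"
  shows "\<not> TAR k G u v A B"
proof
  assume "TAR k G u v A B"
  then have "(step (tar_adjacent k))\<^sup>*\<^sup>* A B" using reconfigurable_iff[OF assms(1)] by blast
  then obtain S where S: "step (tar_adjacent k) S B" using assms(2) by (auto elim: rtranclp.cases)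
  then have "uv_separator G u v S" by (simp add: step_def)
  \<comment> \<open>A removal would start from more than \<open>k\<close> vertices, so
    \<open>B\<close> arises by an addition to a proper subset.\<close>
  moreover from S have "S \<subset> B"
    by (cases rule: step_tar_cases) (use assms(4) in auto)
  ultimately show False using assms(3) by (auto simp: minimal_uv_separator_def)
qed

section \<open>Normalised separators\<close>

text \<open>A relation and not a function, as the outcome depends on the order in which a program
  visits the vertices. \<open>T\<close> is \<open>S\<close> padded as far as the bound
  \<open>k\<close> and the non-terminals permit; at most one vertex is taken out of it
  again.\<close>

definition normalises :: "nat \<Rightarrow> 'a set \<Rightarrow> 'a set \<Rightarrow> bool" where
  "normalises k S S' \<longleftrightarrow>
     (\<exists>T. S \<subseteq> T \<and> T \<subseteq> inner \<and> card T \<le> k \<and> (card T = k \<or> T = inner) \<and>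
          (S' = T \<and> (card T < k \<or> (\<forall>x\<in>T. \<not> uv_separator G u v (T - {x}))) \<or>
           (card T = k \<and> (\<exists>x\<in>T. S' = T - {x}) \<and> uv_separator G u v S')))"

text \<open>Three outcomes, all reached by TAR moves: a set one below the bound, all non-terminals
  when they are fewer than \<open>k\<close>, or \<open>S\<close> unchanged. The last one arises when
  \<open>T\<close> is full and minimal.\<close>

lemma normalises_cases:
  assumes "normalises k S S'" "uv_separator G u v S" "card S \<le> k"
  shows "uv_separator G u v S' \<and> card S' \<le> k \<and> (step (tar_adjacent k))\<^sup>*\<^sup>* S S' \<and>
    (0 < k \<and> card S' = k - 1 \<or> S' = inner \<and> card inner < k \<or>
     S' = S \<and> minimal_uv_separator G u v S \<and> card S = k)"
proof -
  from assms(1) obtain T where T: "S \<subseteq> T" "T \<subseteq> inner" "card T \<le> k" "card T = k \<or> T = inner"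
    and S': "S' = T \<and> (card T < k \<or> (\<forall>x\<in>T. \<not> uv_separator G u v (T - {x}))) \<or>
           (card T = k \<and> (\<exists>x\<in>T. S' = T - {x}) \<and> uv_separator G u v S')"
    unfolding normalises_def by blast
  have sepT: "uv_separator G u v T" using separator_mono assms(2) T by blast
  have finT: "finite T" using sepT by (rule finite_separator)
  have ST: "(step (tar_adjacent k))\<^sup>*\<^sup>* S T" using steps_tar_superset[OF assms(2) T(1-3)] .
  consider (small) "S' = T" "card T < k"
    | (min) "S' = T" "card T = k" "minimal_uv_separator G u v T"
    | (shrunk) x where "card T = k" "x \<in> T" "S' = T - {x}" "uv_separator G u v S'"
    using S' T(3) sepT by (auto simp: minimal_separator_iff le_less)
  then show ?thesis
  proof cases
    case small
    then show ?thesis using T ST sepT by auto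
  next
    case min
    \<comment> \<open>A minimal separator contains no smaller one, so nothing was padded.\<close>
    then have "S = T" using assms(2) T(1) by (auto simp: minimal_uv_separator_def)
    then show ?thesis using min sepT ST by auto
  next
    case shrunk
    have c: "k = Suc (card S')" using shrunk(1,3) card_Suc_Diff1[OF finT shrunk(2)] by (simp only:)
    have "insert x S' = T" using shrunk by auto
    then have "step (tar_adjacent k) T S'"
      using step_tar_insert(2)[OF shrunk(4), of x k] shrunk(2,3) c T(2) by auto
    then have "(step (tar_adjacent k))\<^sup>*\<^sup>* S S'" using ST by simp
    then show ?thesis using shrunk(4) c by auto
  qed
qed

text \<open>There is no room for padding, and minimality forbids the removal.\<close>

lemma normalises_minimal_separator:
  assumes "normalises k S S'" "minimal_uv_separator G u v S" "card S = k"
  shows "S' = S"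
proof -
  from assms(1) obtain T where T: "S \<subseteq> T" "T \<subseteq> inner" "card T \<le> k"
    and S': "S' = T \<or> (\<exists>x\<in>T. S' = T - {x}) \<and> uv_separator G u v S'"
    unfolding normalises_def by blast
  have "finite T" using T(2) finite_inner finite_subset by blast
  then have "S = T" using T assms(3) card_seteq by blast
  then show ?thesis using S' assms(2) by (auto simp: minimal_separator_iff)
qed

text \<open>TAR moves can be reversed, so passing to \<open>A'\<close> and \<open>B'\<close>
  preserves the answer. These two sets coincide, or both have \<open>k - 1\<close> vertices and the
  comparison of TJ with TAR applies.\<close>

lemma TAR_iff_TJ_normalised:
  assumes sep: "uv_separator G u v A" "uv_separator G u v B"
    and card: "card A \<le> k" "card B \<le> k"
    and nontriv: "\<not> (A \<noteq> B \<and> (minimal_uv_separator G u v A \<and> card A = k \<or>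
                       minimal_uv_separator G u v B \<and> card B = k))"
    and norm: "normalises k A A'" "normalises k B B'"
  shows "uv_separator G u v A' \<and> uv_separator G u v B' \<and> card A' = card B' \<and> card B' \<le> k \<and>
    (TAR k G u v A B \<longleftrightarrow> TJ G u v A' B') \<and>
    ereal_of_enat (dist_TJ G u v A' B') = ereal_of_enat (dist_TAR k G u v A' B') / 2"
proof -
  note a = normalises_cases[OF norm(1) sep(1) card(1)]
  note b = normalises_cases[OF norm(2) sep(2) card(2)]
  have sep': "uv_separator G u v A'" "uv_separator G u v B'" "card B' \<le> k" using a b by auto
  have "(step (tar_adjacent k))\<^sup>*\<^sup>* A B \<longleftrightarrow> (step (tar_adjacent k))\<^sup>*\<^sup>* A' B'"
    using a b steps_tar_sym by (meson rtranclp_trans)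
  then have TAR: "TAR k G u v A B \<longleftrightarrow> TAR k G u v A' B'"
    using reconfigurable_iff sep sep' by simp
  have "A' = B' \<or> 0 < k \<and> card A' = k - 1 \<and> card B' = k - 1"
  proof -
    have le: "card A \<le> card inner" "card B \<le> card inner"
      "card A' \<le> card inner" "card B' \<le> card inner"
      using sep sep' separator_inner finite_inner by (simp_all add: card_mono)
    \<comment> \<open>Settles the mixed outcome: when there are fewer than \<open>k\<close>
      non-terminals, a set of size \<open>k - 1\<close> comprises all of them.\<close>
    have full: "X = inner" if "uv_separator G u v X" "card X = k - 1" "card inner < k" for X
      using that separator_inner[OF that(1)] card_seteq[OF finite_inner] by simp
    show ?thesis
    proof (cases "minimal_uv_separator G u v A \<and> card A = k \<or> minimal_uv_separator G u v B \<and> card B = k")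
      case True
      \<comment> \<open>A full minimal separator occurs only in the trivial instance, where
        normalisation leaves both sets alone.\<close>
      then have "A = B" using nontriv by blast
      then have "A' = A" "B' = A" using True norm normalises_minimal_separator by blast+
      then show ?thesis by simp
    next
      case False
      then show ?thesis using a b full[OF sep'(1)] full[OF sep'(2)] by blast
    qed
  qed
  then show ?thesis
  proof (elim disjE conjE)
    assume "A' = B'"
    then show ?thesis using sep' TAR
      by (simp add: reconf_dist_self reconfigurable_iff zero_enat_def[symmetric])
  next
    assume "0 < k" "card A' = k - 1" "card B' = k - 1"
    \<comment> \<open>\<open>0 < k\<close> ensures that the bound \<open>k - 1 + 1\<close> is
      \<open>k\<close> despite truncated subtraction.\<close>
    then show ?thesis
      using TJ_iff_TAR[OF sep'(1), of "k - 1" B'] dist_TJ_eq_half_dist_TAR[OF sep'(1), of "k - 1" B']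
        TAR sep' by simp
  qed
qed

end


section \<open>Time-bounded execution\<close>

text \<open>Total correctness within \<open>T\<close> steps. An upper bound instead of the exact
  time lets branches of different lengths share one estimate.\<close>

definition runs :: "ram_prog \<Rightarrow> store \<Rightarrow> nat \<Rightarrow> (store \<Rightarrow> bool) \<Rightarrow> bool" where
  "runs p s T Q \<longleftrightarrow> (\<exists>t s'. ram_exec p s t s' \<and> t \<le> T \<and> Q s')"

fun writes :: "ram_prog \<Rightarrow> string set" where
  "writes Skip = {}"
| "writes (Assign x a b) = {x}"
| "writes (Seq p q) = writes p \<union> writes q"
| "writes (Cond g p q) = writes p \<union> writes q"
| "writes (While g p) = writes p"

lemma ram_exec_frame: "ram_exec p s t s' \<Longrightarrow> x \<notin> writes p \<Longrightarrow> s' x = s x"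
  by (induction rule: ram_exec.induct) auto

text \<open>The new postcondition may use that banks not written are unchanged, so loop invariants
  need not mention them.\<close>

lemma runs_conseq:
  assumes "runs p s T Q" "T \<le> T'" "\<And>s'. \<forall>x. x \<notin> writes p \<longrightarrow> s' x = s x \<Longrightarrow> Q s' \<Longrightarrow> Q' s'"
  shows "runs p s T' Q'"
proof -
  from assms(1) obtain t s' where "ram_exec p s t s'" "t \<le> T" "Q s'" by (auto simp: runs_def)
  moreover from this(1) have "\<forall>x. x \<notin> writes p \<longrightarrow> s' x = s x" using ram_exec_frame by blast
  ultimately show ?thesis using assms(2,3) unfolding runs_def by (meson le_trans)
qed

lemma runs_Skip: "Q s \<Longrightarrow> 1 \<le> T \<Longrightarrow> runs Skip s T Q"
  unfolding runs_def using ram_exec.Skip by blast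

lemma runs_Assign:
  "Q (s(x := (s x)(ram_eval a s := ram_eval b s))) \<Longrightarrow> 1 \<le> T \<Longrightarrow> runs (Assign x a b) s T Q"
  unfolding runs_def using ram_exec.Assign by blast

lemma runs_Seq:
  assumes "runs p s T Q"
    and "\<And>s'. \<forall>x. x \<notin> writes p \<longrightarrow> s' x = s x \<Longrightarrow> Q s' \<Longrightarrow> runs q s' T' Q'"
    and "T + T' \<le> T''"
  shows "runs (Seq p q) s T'' Q'"
proof -
  have "runs p s T (\<lambda>s'. runs q s' T' Q')"
    by (rule runs_conseq[OF assms(1) order_refl]) (rule assms(2))
  then obtain t s' t' s'' where *: "ram_exec p s t s'" "ram_exec q s' t' s''" "t \<le> T" "t' \<le> T'" "Q' s''"
    unfolding runs_def by blast
  have "t + t' \<le> T''" using *(3,4) assms(3) by linarith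
  then show ?thesis using ram_exec.Seq[OF *(1,2)] *(5) unfolding runs_def by blast
qed

lemma runs_Cond:
  assumes "ram_eval g s \<noteq> 0 \<Longrightarrow> runs p s T Q" "ram_eval g s = 0 \<Longrightarrow> runs q s T Q" "T + 1 \<le> T'"
  shows "runs (Cond g p q) s T' Q"
proof (cases "ram_eval g s = 0")
  case True
  from assms(2)[OF this] obtain t s' where "ram_exec q s t s'" "t \<le> T" "Q s'"
    by (auto simp: runs_def)
  then show ?thesis using ram_exec.CondFalse[OF True, of q t s' p] assms(3)
    unfolding runs_def by (intro exI[of _ "1 + t"] exI[of _ s']) auto
next
  case False
  from assms(1)[OF this] obtain t s' where "ram_exec p s t s'" "t \<le> T" "Q s'"
    by (auto simp: runs_def)
  then show ?thesis using ram_exec.CondTrue[OF False, of p t s' q] assms(3)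
    unfolding runs_def by (intro exI[of _ "1 + t"] exI[of _ s']) auto
qed

lemma runs_Cond_Suc:
  "(ram_eval g s \<noteq> 0 \<Longrightarrow> runs p s T Q) \<Longrightarrow> (ram_eval g s = 0 \<Longrightarrow> runs q s T Q) \<Longrightarrow>
    runs (Cond g p q) s (Suc T) Q"
  by (rule runs_Cond) auto

lemma runs_Assign_Seq:
  assumes "runs q (s(x := (s x)(ram_eval a s := ram_eval b s))) T Q"
  shows "runs (Seq (Assign x a b) q) s (Suc T) Q"
  by (rule runs_Seq[where Q = "\<lambda>s'. s' = s(x := (s x)(ram_eval a s := ram_eval b s))" and T = 1
        and T' = T])
    (use assms in \<open>auto intro: runs_Assign\<close>)

abbreviation var :: "string \<Rightarrow> ram_exp" where
  "var x \<equiv> Cell x (Const 0)"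

section \<open>Counting loops\<close>

definition For :: "string \<Rightarrow> ram_exp \<Rightarrow> ram_prog \<Rightarrow> ram_prog" where
  "For i N p =
     Seq (Assign i (Const 0) (Const 0))
       (While (Monus N (var i)) (Seq p (Assign i (Const 0) (Plus (var i) (Const 1)))))"

lemma writes_For [simp]: "writes (For i N p) = insert i (writes p)"
  by (auto simp: For_def)

text \<open>\<open>I j\<close> describes the store with the counter already at \<open>j\<close>,
  hence the update of \<open>i\<close> after the body. \<open>N\<close> is evaluated anew in each
  round, so its value must survive what the loop writes. A round costs the body, a guard and an
  increment; the extra 2 pays for the initialisation and the last guard.\<close>

lemma runs_For:
  assumes "i \<notin> writes p"
    and bound: "\<And>s'. \<forall>x. x \<notin> insert i (writes p) \<longrightarrow> s' x = s x \<Longrightarrow> ram_eval N s' = n"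
    and init: "I 0 (s(i := (s i)(0 := 0)))"
    and body: "\<And>j s'. j < n \<Longrightarrow> \<forall>x. x \<notin> insert i (writes p) \<longrightarrow> s' x = s x \<Longrightarrow> s' i 0 = j \<Longrightarrow> I j s' \<Longrightarrow>
      runs p s' T (\<lambda>s''. I (Suc j) (s''(i := (s'' i)(0 := Suc j))))"
    and "n \<le> L"
  shows "runs (For i N p) s (L * (T + 2) + 2) (I n)"
proof -
  let ?inc = "Assign i (Const 0) (Plus (var i) (Const 1))"
  let ?loop = "While (Monus N (var i)) (Seq p ?inc)"
  have loop: "runs ?loop s' ((n - j) * (T + 2) + 1) (I n)"
    if "j \<le> n" "\<forall>x. x \<notin> insert i (writes p) \<longrightarrow> s' x = s x" "s' i 0 = j" "I j s'" for j s'
    using that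
  proof (induction "n - j" arbitrary: j s')
    case 0
    then have "ram_eval (Monus N (var i)) s' = 0" using bound by simp
    from ram_exec.WhileFalse[OF this] show ?case
      using 0 unfolding runs_def by fastforce
  next
    case (Suc d)
    then have j: "j < n" by simp
    then have guard: "ram_eval (Monus N (var i)) s' \<noteq> 0" using bound[OF Suc.prems(2)] Suc.prems(3) by simp
    have "runs (Seq p ?inc) s' (T + 1) (\<lambda>s''. (\<forall>x. x \<notin> insert i (writes p) \<longrightarrow> s'' x = s x) \<and>
        s'' i 0 = Suc j \<and> I (Suc j) s'')"
    proof (rule runs_Seq[OF body[OF j Suc.prems(2-4)]])
      fix s''
      assume fr: "\<forall>x. x \<notin> writes p \<longrightarrow> s'' x = s' x"
        and I: "I (Suc j) (s''(i := (s'' i)(0 := Suc j)))"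
      have "s'' i 0 = j" using fr assms(1) Suc.prems(3) by simp
      then show "runs ?inc s'' 1 (\<lambda>s''. (\<forall>x. x \<notin> insert i (writes p) \<longrightarrow> s'' x = s x) \<and>
        s'' i 0 = Suc j \<and> I (Suc j) s'')"
        using fr I Suc.prems(2) by (intro runs_Assign) auto
    qed simp
    then obtain t s'' where s'': "ram_exec (Seq p ?inc) s' t s''" "t \<le> T + 1"
      "\<forall>x. x \<notin> insert i (writes p) \<longrightarrow> s'' x = s x" "s'' i 0 = Suc j" "I (Suc j) s''"
      by (auto simp: runs_def)
    have "runs ?loop s'' ((n - Suc j) * (T + 2) + 1) (I n)"
      by (rule Suc.hyps(1)) (use Suc.hyps(2) j s''(3-5) in auto)
    then obtain t' s3 where s3: "ram_exec ?loop s'' t' s3" "t' \<le> (n - Suc j) * (T + 2) + 1" "I n s3"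
      by (auto simp: runs_def)
    have "n - j = Suc (n - Suc j)" using j by simp
    then have "1 + t + t' \<le> (n - j) * (T + 2) + 1" using s''(2) s3(2) by simp
    then show ?case using ram_exec.WhileTrue[OF guard s''(1) s3(1)] s3(3)
      unfolding runs_def by blast
  qed
  have "runs (For i N p) s (1 + (n * (T + 2) + 1)) (I n)"
    unfolding For_def
  proof (rule runs_Seq)
    let ?s = "s(i := (s i)(0 := 0))"
    show "runs (Assign i (Const 0) (Const 0)) s 1 (\<lambda>s'. s' = ?s)"
      by (rule runs_Assign) auto
    show "runs ?loop s' (n * (T + 2) + 1) (I n)" if "s' = ?s" for s'
      using loop[of 0 ?s] init that by simp
  qed simp
  moreover have "1 + (n * (T + 2) + 1) \<le> L * (T + 2) + 2" 
    using mult_le_mono1[OF \<open>n \<le> L\<close>, of "T + 2"] by linarith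
  ultimately show ?thesis by (rule runs_conseq) simp
qed


section \<open>Reading an instance\<close>

text \<open>
  The word of a TAR instance is \<open>n\<close>, the \<open>n\<close> vertices, \<open>m\<close>, the \<open>m\<close> edges with two entries each,
  \<open>u\<close>, \<open>v\<close>, \<open>|S\<^sub>a|\<close>, \<open>S\<^sub>a\<close>, \<open>|S\<^sub>b|\<close>, \<open>S\<^sub>b\<close>, \<open>k\<close>. The terminals thus stand where an edge number \<open>m\<close> would be.
\<close>

definition num_verts :: "(nat \<Rightarrow> nat) \<Rightarrow> nat" where
  "num_verts W = W 0"

definition num_edges :: "(nat \<Rightarrow> nat) \<Rightarrow> nat" where
  "num_edges W = W (num_verts W + 1)"

text \<open>Pairs are addressed by \<open>j + j\<close>, as the machine has no multiplication; the 2
  accounts for the cells that hold the two counts.\<close>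

definition edge_fst :: "(nat \<Rightarrow> nat) \<Rightarrow> nat \<Rightarrow> nat" where
  "edge_fst W j = W (num_verts W + 2 + (j + j))"

definition edge_snd :: "(nat \<Rightarrow> nat) \<Rightarrow> nat \<Rightarrow> nat" where
  "edge_snd W j = W (num_verts W + 3 + (j + j))"

definition src :: "(nat \<Rightarrow> nat) \<Rightarrow> nat" where
  "src W = edge_fst W (num_edges W)"

definition tgt :: "(nat \<Rightarrow> nat) \<Rightarrow> nat" where
  "tgt W = edge_snd W (num_edges W)"

text \<open>The 4 accounts for the two counts and the two terminals in front of the first
  set.\<close>

definition pos_a :: "(nat \<Rightarrow> nat) \<Rightarrow> nat" where
  "pos_a W = num_verts W + 4 + (num_edges W + num_edges W)"

definition pos_b :: "(nat \<Rightarrow> nat) \<Rightarrow> nat" where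
  "pos_b W = pos_a W + 1 + W (pos_a W)"

definition size_bound :: "(nat \<Rightarrow> nat) \<Rightarrow> nat" where
  "size_bound W = W (pos_b W + 1 + W (pos_b W))"

abbreviation input :: "ram_exp \<Rightarrow> ram_exp" where
  "input \<equiv> Cell ''in''"

text \<open>The parameters are read off the input bank afresh wherever they occur: the programs
  below never write to it, and nested expressions are evaluated within one step.\<close>

definition e_n :: ram_exp where "e_n = input (Const 0)"
definition e_m :: ram_exp where "e_m = input (Plus e_n (Const 1))"
definition e_fst :: "ram_exp \<Rightarrow> ram_exp" where
  "e_fst j = input (Plus (Plus e_n (Const 2)) (Plus j j))"
definition e_snd :: "ram_exp \<Rightarrow> ram_exp" where
  "e_snd j = input (Plus (Plus e_n (Const 3)) (Plus j j))"
definition e_a :: ram_exp where "e_a = Plus (Plus e_n (Const 4)) (Plus e_m e_m)"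
definition e_b :: ram_exp where "e_b = Plus (Plus e_a (Const 1)) (input e_a)"
definition e_k :: ram_exp where "e_k = input (Plus (Plus e_b (Const 1)) (input e_b))"

lemma eval_input [simp]:
  "ram_eval e_n s = num_verts (s ''in'')"
  "ram_eval e_m s = num_edges (s ''in'')"
  "ram_eval (e_fst j) s = edge_fst (s ''in'') (ram_eval j s)"
  "ram_eval (e_snd j) s = edge_snd (s ''in'') (ram_eval j s)"
  "ram_eval e_a s = pos_a (s ''in'')"
  "ram_eval e_b s = pos_b (s ''in'')"
  "ram_eval e_k s = size_bound (s ''in'')"
  by (simp_all add: e_n_def e_m_def e_fst_def e_snd_def e_a_def e_b_def e_k_def num_verts_def
      num_edges_def edge_fst_def edge_snd_def pos_a_def pos_b_def size_bound_def)

text \<open>Banks hold vertex sets as characteristic functions; the cut at \<open>n\<close> keeps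
  these finite, whatever the rest of the bank contains.\<close>

definition marked :: "nat \<Rightarrow> (nat \<Rightarrow> nat) \<Rightarrow> nat set" where
  "marked n M = {i. i < n \<and> M i \<noteq> 0}"

lemma marked_upd [simp]:
  "marked n (M(x := c)) = (if c \<noteq> 0 \<and> x < n then insert x (marked n M) else marked n M - {x})"
  by (auto simp: marked_def)

lemma finite_marked [simp]: "finite (marked n M)"
  by (simp add: marked_def)

lemma in_marked: "x < n \<Longrightarrow> x \<in> marked n M \<longleftrightarrow> M x \<noteq> 0"
  by (simp add: marked_def)

lemma card_marked_le: "card (marked n M) \<le> n"
  using card_mono[of "{..<n}" "marked n M"] by (auto simp: marked_def)


section \<open>Testing for a separator\<close>

text \<open>The counterpart of \<open>arcs_avoiding\<close> on vertex numbers. Edges are listed in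
  one orientation, so both are taken.\<close>

definition word_arcs :: "(nat \<Rightarrow> nat) \<Rightarrow> nat set \<Rightarrow> (nat \<times> nat) set" where
  "word_arcs W A =
     {(x, y). (\<exists>j<num_edges W. (x, y) = (edge_fst W j, edge_snd W j) \<or>
                              (x, y) = (edge_snd W j, edge_fst W j)) \<and> x \<notin> A \<and> y \<notin> A}"

definition word_separates :: "(nat \<Rightarrow> nat) \<Rightarrow> nat set \<Rightarrow> bool" where
  "word_separates W A \<longleftrightarrow> (src W, tgt W) \<notin> (word_arcs W A)\<^sup>*"

definition word_wf :: "(nat \<Rightarrow> nat) \<Rightarrow> bool" where
  "word_wf W \<longleftrightarrow> src W < num_verts W \<and> tgt W < num_verts W \<and>
     (\<forall>j<num_edges W. edge_fst W j < num_verts W \<and> edge_snd W j < num_verts W)"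

text \<open>Banks are used again by later searches and by the second normalisation, so they cannot
  be assumed to be zero.\<close>

definition clear :: "string \<Rightarrow> string \<Rightarrow> ram_prog" where
  "clear x b = For x e_n (Assign b (var x) (Const 0))"

lemma writes_clear [simp]: "writes (clear x b) = {x, b}"
  by (simp add: clear_def)

lemma runs_clear:
  assumes "x \<noteq> b" "x \<noteq> ''in''" "b \<noteq> ''in''" "num_verts (s ''in'') \<le> L"
  shows "runs (clear x b) s (L * 3 + 2) (\<lambda>s'. marked (num_verts (s ''in'')) (s' b) = {})"
proof -
  have "runs (clear x b) s (L * (1 + 2) + 2) (\<lambda>s'. marked (num_verts (s ''in'')) (s' b) = {})"
    unfolding clear_def
    by (rule runs_For[where I = "\<lambda>j s'. marked j (s' b) = {}"])
      (use assms in \<open>auto intro!: runs_Assign simp: marked_def less_Suc_eq\<close>)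
  then show ?thesis by (rule runs_conseq) auto
qed

section \<open>Reachability by relaxing edges\<close>

text \<open>\<open>Plus\<close> acts as disjunction in the guards. Both ends are marked without
  asking which one had been reached, since an edge can be walked in both directions.\<close>

definition relax :: ram_prog where
  "relax =
     Cond (Plus (Cell ''mem'' (e_fst (var ''j''))) (Cell ''mem'' (e_snd (var ''j'')))) Skip
       (Cond (Plus (Cell ''reach'' (e_fst (var ''j''))) (Cell ''reach'' (e_snd (var ''j''))))
         (Seq (Assign ''reach'' (e_fst (var ''j'')) (Const 1))
              (Assign ''reach'' (e_snd (var ''j'')) (Const 1)))
         Skip)"

definition relax_all :: ram_prog where
  "relax_all = For ''j'' e_m relax"

definition search :: ram_prog where
  "search =
     Seq (clear ''i'' ''reach'')
       (Seq (Assign ''reach'' (e_fst e_m) (Const 1)) (For ''i'' e_n relax_all))"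

lemma writes_relax [simp]: "writes relax = {''reach''}"
  by (simp add: relax_def)

lemma writes_relax_all [simp]: "writes relax_all = {''j'', ''reach''}"
  by (auto simp: relax_all_def)

lemma writes_search [simp]: "writes search = {''i'', ''j'', ''reach''}"
  by (auto simp: search_def)

lemma runs_relax:
  fixes s :: store
  defines "W \<equiv> s ''in''"
  defines "x \<equiv> edge_fst W (s ''j'' 0)" and "y \<equiv> edge_snd W (s ''j'' 0)"
    and "A \<equiv> marked (num_verts W) (s ''mem'')" and "R \<equiv> marked (num_verts W) (s ''reach'')"
  assumes "x < num_verts W" "y < num_verts W"
  shows "runs relax s 4 (\<lambda>s'. marked (num_verts W) (s' ''reach'') =
    (if x \<notin> A \<and> y \<notin> A \<and> (x \<in> R \<or> y \<in> R) then R \<union> {x, y} else R))"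
  \<comment> \<open>Writing 4 with successors lets the rules consume one step per command.\<close>
  unfolding relax_def numeral_nat
  using assms(6,7)
  by (intro runs_Cond_Suc runs_Assign_Seq runs_Assign runs_Skip)
    (auto simp: x_def y_def W_def A_def R_def in_marked)

definition arc_closed :: "(nat \<Rightarrow> nat) \<Rightarrow> nat set \<Rightarrow> nat set \<Rightarrow> nat \<Rightarrow> bool" where
  "arc_closed W A R j \<longleftrightarrow>
     (edge_fst W j \<notin> A \<and> edge_snd W j \<notin> A \<longrightarrow> (edge_fst W j \<in> R \<longleftrightarrow> edge_snd W j \<in> R))"

text \<open>No edge that avoids \<open>A\<close> leaves a closed set, so walks cannot leave it
  either. This is the completeness of the search; its soundness is carried as an invariant.\<close>

lemma arc_closed_reachable:
  assumes "\<forall>j<num_edges W. arc_closed W A R j" "x \<in> R" "(x, y) \<in> (word_arcs W A)\<^sup>*"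
  shows "y \<in> R"
  using assms(3,2)
proof induction
  case (step y z)
  then show ?case using assms(1) by (auto simp: word_arcs_def arc_closed_def)
qed

text \<open>A round that marks nothing new has inspected every edge against the same set
  \<open>R\<close>, so \<open>R\<close> is closed; otherwise the set has grown strictly. This
  dichotomy limits the number of rounds.\<close>

lemma runs_relax_all:
  fixes s :: store
  defines "W \<equiv> s ''in''"
  defines "A \<equiv> marked (num_verts W) (s ''mem'')" and "R \<equiv> marked (num_verts W) (s ''reach'')"
  assumes wf: "word_wf W" and "num_edges W \<le> L"
    and reach: "\<forall>x\<in>R. (src W, x) \<in> (word_arcs W A)\<^sup>*"
  shows "runs relax_all s (L * 6 + 2) (\<lambda>s'. let R' = marked (num_verts W) (s' ''reach'') in
    R \<subseteq> R' \<and> (\<forall>x\<in>R'. (src W, x) \<in> (word_arcs W A)\<^sup>*) \<and>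
    (R = R' \<and> (\<forall>j<num_edges W. arc_closed W A R j) \<or> R \<subset> R'))"
proof -
  define I where "I = (\<lambda>n (s' :: store). let R' = marked (num_verts W) (s' ''reach'') in
    R \<subseteq> R' \<and> (\<forall>x\<in>R'. (src W, x) \<in> (word_arcs W A)\<^sup>*) \<and>
    (R = R' \<and> (\<forall>j<n. arc_closed W A R j) \<or> R \<subset> R'))"
  have "runs relax_all s (L * (4 + 2) + 2) (I (num_edges W))"
    unfolding relax_all_def
  proof (rule runs_For[where n = "num_edges W"])
    show "I 0 (s(''j'' := (s ''j'')(0 := 0)))"
      using reach by (auto simp: I_def R_def Let_def)
  next
    fix j s'
    assume j: "j < num_edges W" and fr: "\<forall>x. x \<notin> insert ''j'' (writes relax) \<longrightarrow> s' x = s x"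
      and s'j: "s' ''j'' 0 = j" and Ij: "I j s'"
    have fr': "s' ''in'' = W" "s' ''mem'' = s ''mem''" using fr by (auto simp: W_def)
    let ?x = "edge_fst W j" and ?y = "edge_snd W j"
    have xy: "?x < num_verts W" "?y < num_verts W" using wf j by (auto simp: word_wf_def)
    define R' where "R' = marked (num_verts W) (s' ''reach'')"
    have R': "R \<subseteq> R'" "\<forall>x\<in>R'. (src W, x) \<in> (word_arcs W A)\<^sup>*"
      "R = R' \<and> (\<forall>i<j. arc_closed W A R i) \<or> R \<subset> R'"
      using Ij by (auto simp: I_def R'_def Let_def)
    show "runs relax s' 4 (\<lambda>s''. I (Suc j) (s''(''j'' := (s'' ''j'')(0 := Suc j))))"
    proof (rule runs_conseq[OF runs_relax], unfold fr' s'j)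
      show "?x < num_verts W" "?y < num_verts W" by fact+
    next
      fix s'' :: store
      assume "marked (num_verts W) (s'' ''reach'') =
        (if ?x \<notin> marked (num_verts W) (s ''mem'') \<and> ?y \<notin> marked (num_verts W) (s ''mem'') \<and>
            (?x \<in> marked (num_verts W) (s' ''reach'') \<or> ?y \<in> marked (num_verts W) (s' ''reach''))
         then marked (num_verts W) (s' ''reach'') \<union> {?x, ?y}
         else marked (num_verts W) (s' ''reach''))"
      then have R'': "marked (num_verts W) (s'' ''reach'') =
        (if ?x \<notin> A \<and> ?y \<notin> A \<and> (?x \<in> R' \<or> ?y \<in> R') then R' \<union> {?x, ?y} else R')"
        by (simp add: A_def R'_def)
      show "I (Suc j) (s''(''j'' := (s'' ''j'')(0 := Suc j)))"
      proof (cases "?x \<notin> A \<and> ?y \<notin> A \<and> (?x \<in> R' \<or> ?y \<in> R')")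
        case True
        have "(?x, ?y) \<in> word_arcs W A" "(?y, ?x) \<in> word_arcs W A"
          using True j by (auto simp: word_arcs_def)
        then have "(src W, ?x) \<in> (word_arcs W A)\<^sup>*" "(src W, ?y) \<in> (word_arcs W A)\<^sup>*"
          using True R'(2) by (auto intro: rtrancl_into_rtrancl)
        \<comment> \<open>If both ends were marked before, the set does not change and the edge is
          closed.\<close>
        moreover have "R = R' \<union> {?x, ?y} \<and> (\<forall>i<Suc j. arc_closed W A R i) \<or> R \<subset> R' \<union> {?x, ?y}"
          using R'(1,3) by (auto simp: arc_closed_def less_Suc_eq)
        ultimately show ?thesis using True R'(1,2) R'' by (auto simp: I_def Let_def)
      next
        case False
        \<comment> \<open>An edge left alone is closed for the current set, which is
          \<open>R\<close> itself as long as nothing has been added.\<close>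
        then have "arc_closed W A R' j" by (auto simp: arc_closed_def)
        then have "R = R' \<and> (\<forall>i<Suc j. arc_closed W A R i) \<or> R \<subset> R'"
          using R'(3) by (auto simp: less_Suc_eq)
        then show ?thesis using False R'(1,2) R'' by (auto simp: I_def Let_def)
      qed
    qed simp
  qed (use assms in \<open>auto simp: W_def\<close>)
  then show ?thesis by (simp add: I_def)
qed

lemma runs_search:
  fixes s :: store
  defines "W \<equiv> s ''in''"
  defines "A \<equiv> marked (num_verts W) (s ''mem'')"
  assumes wf: "word_wf W" and L: "num_verts W \<le> L" "num_edges W \<le> L"
  shows "runs search s (L * (L * 6 + 4) + L * 3 + 5)
    (\<lambda>s'. s' ''reach'' (tgt W) = 0 \<longleftrightarrow> word_separates W A)"
proof -
  let ?n = "num_verts W"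
  \<comment> \<open>After \<open>r\<close> rounds the marked set is closed or has more than
    \<open>r\<close> elements; initially it is \<open>{src W}\<close>.\<close>
  define I where "I = (\<lambda>r (s' :: store). let R = marked ?n (s' ''reach'') in
    src W \<in> R \<and> (\<forall>x\<in>R. (src W, x) \<in> (word_arcs W A)\<^sup>*) \<and>
    ((\<forall>j<num_edges W. arc_closed W A R j) \<or> r < card R))"
  have src: "src W < ?n" and tgt: "tgt W < ?n" using wf by (auto simp: word_wf_def)
  have For: "runs (For ''i'' e_n relax_all) s1 (L * ((L * 6 + 2) + 2) + 2) (I ?n)"
    if s1: "s1 ''in'' = W" "s1 ''mem'' = s ''mem''" "marked ?n (s1 ''reach'') = {src W}" for s1
  proof (rule runs_For[where n = ?n])
    show "I 0 (s1(''i'' := (s1 ''i'')(0 := 0)))" using s1(3) by (simp add: I_def)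
  next
    fix r s'
    assume fr: "\<forall>x. x \<notin> insert ''i'' (writes relax_all) \<longrightarrow> s' x = s1 x" and Ir: "I r s'"
    have fr': "s' ''in'' = W" "s' ''mem'' = s ''mem''" using fr s1 by auto
    define R where "R = marked ?n (s' ''reach'')"
    have R: "src W \<in> R" "\<forall>x\<in>R. (src W, x) \<in> (word_arcs W A)\<^sup>*"
      "(\<forall>j<num_edges W. arc_closed W A R j) \<or> r < card R"
      using Ir by (auto simp: I_def R_def Let_def)
    note ra = runs_relax_all[of s' L, unfolded fr', folded A_def R_def, OF wf L(2) R(2)]
    show "runs relax_all s' (L * 6 + 2) (\<lambda>s''. I (Suc r) (s''(''i'' := (s'' ''i'')(0 := Suc r))))"
    proof (rule runs_conseq[OF ra order_refl])
      fix s'' :: store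
      define R' where "R' = marked ?n (s'' ''reach'')"
      assume "let R' = marked ?n (s'' ''reach'') in
        R \<subseteq> R' \<and> (\<forall>x\<in>R'. (src W, x) \<in> (word_arcs W A)\<^sup>*) \<and>
        (R = R' \<and> (\<forall>j<num_edges W. arc_closed W A R j) \<or> R \<subset> R')"
      then have R': "R \<subseteq> R'" "\<forall>x\<in>R'. (src W, x) \<in> (word_arcs W A)\<^sup>*"
        "R = R' \<and> (\<forall>j<num_edges W. arc_closed W A R j) \<or> R \<subset> R'"
        by (auto simp: R'_def Let_def)
      have "(\<forall>j<num_edges W. arc_closed W A R' j) \<or> Suc r < card R'"
      proof (cases "R \<subset> R'")
        case True
        \<comment> \<open>A closed \<open>R\<close> contains everything reachable and could not have
          grown. Hence the counting alternative held before this round, and the count rises by at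
          least one.\<close>
        then have "\<not> (\<forall>j<num_edges W. arc_closed W A R j)"
          using arc_closed_reachable[of W A R "src W"] R(1) R'(2) by blast
        then have "r < card R" using R(3) by blast
        moreover have "card R < card R'"
          using True by (intro psubset_card_mono) (auto simp: R'_def)
        ultimately show ?thesis by simp
      qed (use R'(3) in auto)
      then show "I (Suc r) (s''(''i'' := (s'' ''i'')(0 := Suc r)))"
        using R(1) R'(1,2) by (auto simp: I_def R'_def Let_def)
    qed
  qed (use s1 L in auto)
  have "runs search s (L * ((L * 6 + 2) + 2) + L * 3 + 5) (I ?n)"
    unfolding search_def
  proof (rule runs_Seq[OF runs_clear])
    fix s1 :: store
    assume s1: "\<forall>x. x \<notin> writes (clear ''i'' ''reach'') \<longrightarrow> s1 x = s x"
      "marked (num_verts (s ''in'')) (s1 ''reach'') = {}"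
    show "runs (Seq (Assign ''reach'' (e_fst e_m) (Const 1)) (For ''i'' e_n relax_all)) s1
      (1 + (L * ((L * 6 + 2) + 2) + 2)) (I ?n)"
    proof (rule runs_Seq[OF _ For])
      have "s1 ''in'' = W" using s1(1) by (simp add: W_def)
      then show "runs (Assign ''reach'' (e_fst e_m) (Const 1)) s1 1
        (\<lambda>s'. marked ?n (s' ''reach'') = {src W})"
        using s1(2) src by (intro runs_Assign) (simp_all add: W_def[symmetric] src_def[symmetric])
    qed (use s1 in \<open>auto simp: W_def\<close>)
  qed (use L in \<open>auto simp: W_def\<close>)
  then have *: "runs search s (L * (L * 6 + 4) + L * 3 + 5) (I ?n)"
    by (rule runs_conseq) (auto simp: algebra_simps)
  show ?thesis
  proof (rule runs_conseq[OF * order_refl])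
    fix s' :: store
    assume I: "I ?n s'"
    define R where "R = marked ?n (s' ''reach'')"
    \<comment> \<open>With only \<open>?n\<close> vertices, the counting alternative is impossible
      after \<open>?n\<close> rounds.\<close>
    have R: "src W \<in> R" "\<forall>x\<in>R. (src W, x) \<in> (word_arcs W A)\<^sup>*"
      "\<forall>j<num_edges W. arc_closed W A R j"
      using I card_marked_le[of ?n "s' ''reach''"] by (auto simp: I_def R_def Let_def)
    then have "tgt W \<in> R \<longleftrightarrow> (src W, tgt W) \<in> (word_arcs W A)\<^sup>*"
      using arc_closed_reachable by blast
    then show "s' ''reach'' (tgt W) = 0 \<longleftrightarrow> word_separates W A"
      using tgt by (auto simp: R_def in_marked word_separates_def)
  qed
qed


section \<open>Normalising a separator\<close>

lemma output_word_upd [simp]: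
  "x \<noteq> ''out'' \<Longrightarrow> x \<noteq> ''outlen'' \<Longrightarrow> output_word (s(x := a)) = output_word s"
  by (simp add: output_word_def)

definition push :: "ram_exp \<Rightarrow> ram_prog" where
  "push e =
     Seq (Assign ''out'' (var ''outlen'') e)
       (Assign ''outlen'' (Const 0) (Plus (var ''outlen'') (Const 1)))"

lemma writes_push [simp]: "writes (push e) = {''out'', ''outlen''}"
  by (auto simp: push_def)

lemma runs_push: "runs (push e) s 2 (\<lambda>s'. output_word s' = output_word s @ [ram_eval e s])"
  unfolding push_def numeral_2_eq_2
  by (intro runs_Assign_Seq runs_Assign) (auto simp: output_word_def)

definition load :: "ram_exp \<Rightarrow> ram_prog" where
  "load p =
     For ''x'' (input p) (Assign ''mem'' (input (Plus (Plus p (Const 1)) (var ''x''))) (Const 1))"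

text \<open>The sum of both truncated differences is the absolute difference.\<close>

definition distinct_exp :: "ram_exp \<Rightarrow> ram_exp \<Rightarrow> ram_exp" where
  "distinct_exp a b = Plus (Monus a b) (Monus b a)"

lemma eval_distinct_exp [simp]:
  "ram_eval (distinct_exp a b) s = 0 \<longleftrightarrow> ram_eval a s = ram_eval b s"
  by (auto simp: distinct_exp_def)

definition pad_step :: ram_prog where
  "pad_step =
     Cond (Cell ''mem'' (var ''x'')) Skip
       (Cond (distinct_exp (var ''x'') (e_fst e_m))
         (Cond (distinct_exp (var ''x'') (e_snd e_m))
           (Cond (Monus e_k (var ''size''))
             (Seq (Assign ''mem'' (var ''x'') (Const 1))
                  (Assign ''size'' (Const 0) (Plus (var ''size'') (Const 1))))
             Skip)
           Skip)
         Skip)"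

text \<open>A vertex is taken out on trial and put back if the search still reaches the target. The
  first guard ends the trials once the size is below the bound, so at most one vertex goes.\<close>

definition shrink_step :: ram_prog where
  "shrink_step =
     Cond (Monus e_k (var ''size'')) Skip
       (Cond (Cell ''mem'' (var ''x''))
         (Seq (Assign ''mem'' (var ''x'') (Const 0))
           (Seq search
             (Cond (Cell ''reach'' (e_snd e_m))
               (Assign ''mem'' (var ''x'') (Const 1))
               (Assign ''size'' (Const 0) (Monus (var ''size'') (Const 1))))))
         Skip)"

definition emit_step :: ram_prog where
  "emit_step = Cond (Cell ''mem'' (var ''x'')) (push (var ''x'')) Skip"

text \<open>\<open>size\<close> accompanies \<open>mem\<close>: it guards padding and shrinking and
  supplies the length that precedes the vertices in the output.\<close>

definition normalise :: "ram_exp \<Rightarrow> ram_prog" where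
  "normalise p =
     Seq (clear ''x'' ''mem'')
       (Seq (load p)
         (Seq (Assign ''size'' (Const 0) (input p))
           (Seq (For ''x'' e_n pad_step)
             (Seq (For ''x'' e_n shrink_step)
               (Seq (push (var ''size'')) (For ''x'' e_n emit_step))))))"

lemma writes_load [simp]: "writes (load p) = {''x'', ''mem''}"
  by (auto simp: load_def)

lemma writes_pad_step [simp]: "writes pad_step = {''mem'', ''size''}"
  by (auto simp: pad_step_def)

lemma writes_shrink_step [simp]:
  "writes shrink_step = {''mem'', ''size'', ''i'', ''j'', ''reach''}"
  by (auto simp: shrink_step_def)

lemma writes_emit_step [simp]: "writes emit_step = {''out'', ''outlen''}"
  by (auto simp: emit_step_def)

lemma writes_normalise [simp]:
  "writes (normalise p) = {''x'', ''mem'', ''size'', ''i'', ''j'', ''reach'', ''out'', ''outlen''}"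
  by (auto simp: normalise_def)

definition word_inner :: "(nat \<Rightarrow> nat) \<Rightarrow> nat set" where
  "word_inner W = {..<num_verts W} - {src W, tgt W}"

section \<open>Correctness and running time of the phases\<close>

lemma runs_load:
  fixes s :: store
  defines "W \<equiv> s ''in''"
  assumes p: "\<And>s'. s' ''in'' = W \<Longrightarrow> ram_eval p s' = q"
    and A: "(\<lambda>i. W (q + 1 + i)) ` {..<W q} \<subseteq> {..<num_verts W}"
    and "marked (num_verts W) (s ''mem'') = {}" "W q \<le> L"
  shows "runs (load p) s (L * 3 + 2)
    (\<lambda>s'. marked (num_verts W) (s' ''mem'') = (\<lambda>i. W (q + 1 + i)) ` {..<W q})"
proof -
  have "runs (load p) s (L * (1 + 2) + 2)
    (\<lambda>s'. marked (num_verts W) (s' ''mem'') = (\<lambda>i. W (q + 1 + i)) ` {..<W q})"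
    unfolding load_def
  proof (rule runs_For[where I = "\<lambda>j s'. marked (num_verts W) (s' ''mem'') = (\<lambda>i. W (q + 1 + i)) ` {..<j}"])
    fix j s'
    assume j: "j < W q" "s' ''x'' 0 = j"
      and fr: "\<forall>x. x \<notin> insert ''x'' (writes (Assign ''mem'' (input (Plus (Plus p (Const 1)) (var ''x''))) (Const 1)))
        \<longrightarrow> s' x = s x"
      and I: "marked (num_verts W) (s' ''mem'') = (\<lambda>i. W (q + 1 + i)) ` {..<j}"
    have in': "s' ''in'' = W" using fr by (simp add: W_def)
    have "W (q + 1 + j) < num_verts W" using A j by auto
    then show "runs (Assign ''mem'' (input (Plus (Plus p (Const 1)) (var ''x''))) (Const 1)) s' 1
      (\<lambda>s''. marked (num_verts W) ((s''(''x'' := (s'' ''x'')(0 := Suc j))) ''mem'') =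
        (\<lambda>i. W (q + 1 + i)) ` {..<Suc j})"
      using in' I j p[of s', OF in'] by (intro runs_Assign) (auto simp: lessThan_Suc)
  next
    fix s' :: store
    assume "\<forall>x. x \<notin> insert ''x'' (writes (Assign ''mem'' (input (Plus (Plus p (Const 1)) (var ''x''))) (Const 1)))
        \<longrightarrow> s' x = s x"
    then have "s' ''in'' = W" by (simp add: W_def)
    then show "ram_eval (input p) s' = W q" using p by simp
  qed (use assms in auto)
  then show ?thesis by (rule runs_conseq) auto
qed

lemma runs_pad_step:
  fixes s :: store
  defines "W \<equiv> s ''in''"
  defines "x \<equiv> s ''x'' 0" and "B \<equiv> marked (num_verts W) (s ''mem'')"
  assumes "x < num_verts W"
  shows "runs pad_step s 6 (\<lambda>s'.
    if x \<in> word_inner W - B \<and> s ''size'' 0 < size_bound W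
    then marked (num_verts W) (s' ''mem'') = insert x B \<and> s' ''size'' 0 = Suc (s ''size'' 0)
    else marked (num_verts W) (s' ''mem'') = B \<and> s' ''size'' 0 = s ''size'' 0)"
  unfolding pad_step_def numeral_nat
  using assms(4)
  by (intro runs_Cond_Suc runs_Assign_Seq runs_Assign runs_Skip)
    (auto simp: x_def W_def B_def word_inner_def src_def tgt_def in_marked)

lemma runs_pad:
  fixes s :: store
  defines "W \<equiv> s ''in''"
  defines "A \<equiv> marked (num_verts W) (s ''mem'')"
  assumes A: "A \<subseteq> word_inner W" "s ''size'' 0 = card A" "card A \<le> size_bound W"
    and L: "num_verts W \<le> L"
  shows "runs (For ''x'' e_n pad_step) s (L * 8 + 2) (\<lambda>s'.
    let B = marked (num_verts W) (s' ''mem'') in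
      A \<subseteq> B \<and> B \<subseteq> word_inner W \<and> s' ''size'' 0 = card B \<and> card B \<le> size_bound W \<and>
      (card B = size_bound W \<or> B = word_inner W))"
proof -
  \<comment> \<open>Either the bound has been reached, or no non-terminal below \<open>j\<close> has
    been passed over.\<close>
  define I where "I = (\<lambda>j (s' :: store). let B = marked (num_verts W) (s' ''mem'') in
      A \<subseteq> B \<and> B \<subseteq> word_inner W \<and> s' ''size'' 0 = card B \<and> card B \<le> size_bound W \<and>
      (card B = size_bound W \<or> (\<forall>i<j. i \<in> word_inner W \<longrightarrow> i \<in> B)))"
  have "runs (For ''x'' e_n pad_step) s (L * (6 + 2) + 2) (I (num_verts W))"
  proof (rule runs_For)
    fix j s'
    assume j: "j < num_verts W" "s' ''x'' 0 = j"
      and fr: "\<forall>x. x \<notin> insert ''x'' (writes pad_step) \<longrightarrow> s' x = s x" and Ij: "I j s'"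
    have in': "s' ''in'' = W" using fr by (simp add: W_def)
    show "runs pad_step s' 6 (\<lambda>s''. I (Suc j) (s''(''x'' := (s'' ''x'')(0 := Suc j))))"
    proof (rule runs_conseq[OF runs_pad_step], unfold in' j(2))
      show "j < num_verts W" by fact
    next
      fix s'' :: store
      let ?B = "marked (num_verts W) (s' ''mem'')"
      assume *: "if j \<in> word_inner W - ?B \<and> s' ''size'' 0 < size_bound W
        then marked (num_verts W) (s'' ''mem'') = insert j ?B \<and> s'' ''size'' 0 = Suc (s' ''size'' 0)
        else marked (num_verts W) (s'' ''mem'') = ?B \<and> s'' ''size'' 0 = s' ''size'' 0"
      show "I (Suc j) (s''(''x'' := (s'' ''x'')(0 := Suc j)))"
      proof (cases "j \<in> word_inner W - ?B \<and> s' ''size'' 0 < size_bound W")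
        case True
        then show ?thesis using * Ij by (auto simp: I_def Let_def less_Suc_eq)
      next
        case False
        then show ?thesis using * Ij by (auto simp: I_def Let_def less_Suc_eq)
      qed
    qed simp
  qed (use A L in \<open>auto simp: I_def A_def W_def Let_def\<close>)
  then show ?thesis
  proof (rule runs_conseq)
    fix s' :: store
    assume "I (num_verts W) s'"
    then show "let B = marked (num_verts W) (s' ''mem'') in
      A \<subseteq> B \<and> B \<subseteq> word_inner W \<and> s' ''size'' 0 = card B \<and> card B \<le> size_bound W \<and>
      (card B = size_bound W \<or> B = word_inner W)"
      by (auto simp: I_def Let_def word_inner_def)
  qed simp
qed

lemma runs_shrink_step:
  fixes s :: store
  defines "W \<equiv> s ''in''"
  defines "x \<equiv> s ''x'' 0" and "B \<equiv> marked (num_verts W) (s ''mem'')"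
  assumes wf: "word_wf W" and L: "num_verts W \<le> L" "num_edges W \<le> L" and x: "x < num_verts W"
  shows "runs shrink_step s (L * (L * 6 + 4) + L * 3 + 10) (\<lambda>s'.
    if size_bound W \<le> s ''size'' 0 \<and> x \<in> B \<and> word_separates W (B - {x})
    then marked (num_verts W) (s' ''mem'') = B - {x} \<and> s' ''size'' 0 = s ''size'' 0 - 1
    else marked (num_verts W) (s' ''mem'') = B \<and> s' ''size'' 0 = s ''size'' 0)"
    (is "runs _ _ _ ?Q")
proof -
  let ?T = "L * (L * 6 + 4) + L * 3 + 5"
  let ?s = "s(''mem'' := (s ''mem'')(x := 0))"
  have s1: "?s ''in'' = W" "marked (num_verts W) (?s ''mem'') = B - {x}"
    by (auto simp: W_def B_def)
  have search: "runs (Seq search (Cond (Cell ''reach'' (e_snd e_m))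
      (Assign ''mem'' (var ''x'') (Const 1))
      (Assign ''size'' (Const 0) (Monus (var ''size'') (Const 1))))) ?s (?T + 2) ?Q"
    if "size_bound W \<le> s ''size'' 0" "x \<in> B"
  proof (rule runs_Seq[OF runs_search[of ?s L, unfolded s1, OF wf L]])
    fix s' :: store
    assume fr: "\<forall>x. x \<notin> writes search \<longrightarrow> s' x = ?s x"
      and sep: "s' ''reach'' (tgt W) = 0 \<longleftrightarrow> word_separates W (B - {x})"
    have fr': "s' ''in'' = W" "s' ''mem'' = (s ''mem'')(x := 0)" "s' ''x'' 0 = x"
      "s' ''size'' = s ''size''"
      using fr by (auto simp: W_def x_def)
    have tgt: "ram_eval (Cell ''reach'' (e_snd e_m)) s' = s' ''reach'' (tgt W)"
      by (simp add: fr' tgt_def)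
    show "runs (Cond (Cell ''reach'' (e_snd e_m))
      (Assign ''mem'' (var ''x'') (Const 1))
      (Assign ''size'' (Const 0) (Monus (var ''size'') (Const 1)))) s' (Suc 1) ?Q"
    proof (rule runs_Cond_Suc, unfold tgt)
      assume "s' ''reach'' (tgt W) \<noteq> 0"
      then have "\<not> word_separates W (B - {x})" using sep by simp
      moreover have "insert x (B - {x}) = B" using that by blast
      ultimately show "runs (Assign ''mem'' (var ''x'') (Const 1)) s' 1 ?Q"
        using x that by (intro runs_Assign) (auto simp: fr' B_def)
    next
      assume "s' ''reach'' (tgt W) = 0"
      then have "word_separates W (B - {x})" using sep by simp
      then show "runs (Assign ''size'' (Const 0) (Monus (var ''size'') (Const 1))) s' 1 ?Q"
        using that by (intro runs_Assign) (auto simp: fr' B_def)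
    qed
  qed simp
  have "runs shrink_step s (Suc (Suc (Suc (?T + 2)))) ?Q"
    unfolding shrink_step_def
  proof (rule runs_Cond_Suc[OF _ runs_Cond_Suc[OF runs_Assign_Seq]])
    assume "ram_eval (Monus e_k (var ''size'')) s \<noteq> 0"
    then show "runs Skip s (Suc (Suc (?T + 2))) ?Q"
      by (intro runs_Skip) (auto simp: W_def B_def)
  next
    assume "ram_eval (Monus e_k (var ''size'')) s = 0" "ram_eval (Cell ''mem'' (var ''x'')) s \<noteq> 0"
    then have "size_bound W \<le> s ''size'' 0" "x \<in> B"
      using x by (auto simp: W_def B_def x_def in_marked)
    from search[OF this] show "runs (Seq search (Cond (Cell ''reach'' (e_snd e_m))
      (Assign ''mem'' (var ''x'') (Const 1))
      (Assign ''size'' (Const 0) (Monus (var ''size'') (Const 1)))))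
      (s(''mem'' := (s ''mem'')(ram_eval (var ''x'') s := ram_eval (Const 0) s))) (?T + 2) ?Q"
      by (simp add: x_def)
  next
    assume "ram_eval (Cell ''mem'' (var ''x'')) s = 0"
    then have "x \<notin> B" using x by (auto simp: W_def B_def x_def in_marked)
    then show "runs Skip s (Suc (?T + 2)) ?Q"
      by (intro runs_Skip) (auto simp: W_def B_def)
  qed
  then show ?thesis by (rule runs_conseq) auto
qed

lemma runs_shrink:
  fixes s :: store
  defines "W \<equiv> s ''in''"
  defines "B \<equiv> marked (num_verts W) (s ''mem'')" and "k \<equiv> size_bound W"
  assumes wf: "word_wf W" and L: "num_verts W \<le> L" "num_edges W \<le> L"
    and B: "s ''size'' 0 = card B" "card B \<le> k"
  shows "runs (For ''x'' e_n shrink_step) s (L * (L * (L * 6 + 4) + L * 3 + 12) + 2) (\<lambda>s'.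
    let A' = marked (num_verts W) (s' ''mem'') in s' ''size'' 0 = card A' \<and>
      (A' = B \<and> (card B < k \<or> (\<forall>x\<in>B. \<not> word_separates W (B - {x}))) \<or>
       card B = k \<and> (\<exists>x\<in>B. A' = B - {x}) \<and> word_separates W A'))"
proof -
  \<comment> \<open>As long as nothing has been dropped, every vertex of a full \<open>B\<close>
    below \<open>j\<close> has been tested in vain. These tests are all made against the same
    \<open>B\<close>, so their outcomes stay valid.\<close>
  define I where "I = (\<lambda>j (s' :: store).
    let A' = marked (num_verts W) (s' ''mem'') in s' ''size'' 0 = card A' \<and>
      (A' = B \<and> (card B < k \<or> (\<forall>x\<in>B. x < j \<longrightarrow> \<not> word_separates W (B - {x}))) \<or>
       card B = k \<and> (\<exists>x\<in>B. A' = B - {x}) \<and> word_separates W A'))"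
  have fin: "finite B" by (simp add: B_def)
  have "runs (For ''x'' e_n shrink_step) s (L * (L * (L * 6 + 4) + L * 3 + 10 + 2) + 2) (I (num_verts W))"
  proof (rule runs_For)
    fix j s'
    assume j: "j < num_verts W" "s' ''x'' 0 = j"
      and fr: "\<forall>x. x \<notin> insert ''x'' (writes shrink_step) \<longrightarrow> s' x = s x" and Ij: "I j s'"
    have in': "s' ''in'' = W" using fr by (simp add: W_def)
    define A' where "A' = marked (num_verts W) (s' ''mem'')"
    show "runs shrink_step s' (L * (L * 6 + 4) + L * 3 + 10)
      (\<lambda>s''. I (Suc j) (s''(''x'' := (s'' ''x'')(0 := Suc j))))"
    proof (rule runs_conseq[OF runs_shrink_step[of s' L, unfolded in' j(2), OF wf L j(1)] order_refl],
        fold k_def A'_def)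
      fix s'' :: store
      assume *: "if k \<le> s' ''size'' 0 \<and> j \<in> A' \<and> word_separates W (A' - {j})
        then marked (num_verts W) (s'' ''mem'') = A' - {j} \<and> s'' ''size'' 0 = s' ''size'' 0 - 1
        else marked (num_verts W) (s'' ''mem'') = A' \<and> s'' ''size'' 0 = s' ''size'' 0"
      from Ij have size: "s' ''size'' 0 = card A'"
        and A': "A' = B \<and> (card B < k \<or> (\<forall>x\<in>B. x < j \<longrightarrow> \<not> word_separates W (B - {x}))) \<or>
          card B = k \<and> (\<exists>x\<in>B. A' = B - {x}) \<and> word_separates W A'"
        by (auto simp: I_def A'_def Let_def)
      show "I (Suc j) (s''(''x'' := (s'' ''x'')(0 := Suc j)))"
      proof (cases "k \<le> s' ''size'' 0 \<and> j \<in> A' \<and> word_separates W (A' - {j})")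
        case True
        then have "k \<le> card A'" using size by simp
        \<comment> \<open>A deletion takes place only while the size is at least \<open>k\<close>,
          so no earlier one has happened.\<close>
        have "A' = B"
        proof (rule ccontr)
          assume "A' \<noteq> B"
          then obtain x where "x \<in> B" "A' = B - {x}" "card B = k" using A' by blast
          then have "card A' < k" using card_Diff1_less[OF fin \<open>x \<in> B\<close>] by simp
          then show False using \<open>k \<le> card A'\<close> by simp
        qed
        moreover have "card (B - {j}) = card B - 1" using True \<open>A' = B\<close> by simp
        ultimately show ?thesis using * True size B(2) \<open>k \<le> card A'\<close>
          by (auto simp: I_def Let_def)
      next
        case False
        then have s'': "marked (num_verts W) (s'' ''mem'') = A'" "s'' ''size'' 0 = card A'"
          using * size by auto
        have "card B < k \<or> \<not> word_separates W (B - {j})" if "A' = B" "j \<in> B"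
          using False that size by auto
        then show ?thesis using s'' A' by (auto simp: I_def Let_def less_Suc_eq)
      qed
    qed
  qed (use B L in \<open>auto simp: I_def B_def W_def Let_def\<close>)
  then show ?thesis
  proof (rule runs_conseq)
    fix s' :: store
    assume "I (num_verts W) s'"
    moreover have "\<forall>x\<in>B. x < num_verts W" by (auto simp: B_def marked_def)
    ultimately show "let A' = marked (num_verts W) (s' ''mem'') in s' ''size'' 0 = card A' \<and>
      (A' = B \<and> (card B < k \<or> (\<forall>x\<in>B. \<not> word_separates W (B - {x}))) \<or>
       card B = k \<and> (\<exists>x\<in>B. A' = B - {x}) \<and> word_separates W A')"
      by (auto simp: I_def Let_def)
  qed simp
qed

lemma runs_emit:
  fixes s :: store
  defines "n \<equiv> num_verts (s ''in'')"
  assumes "n \<le> L"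
  shows "runs (For ''x'' e_n emit_step) s (L * 5 + 2)
    (\<lambda>s'. output_word s' = output_word s @ filter (\<lambda>i. i \<in> marked n (s ''mem'')) [0..<n])"
proof -
  have "runs (For ''x'' e_n emit_step) s (L * (3 + 2) + 2)
    (\<lambda>s'. output_word s' = output_word s @ filter (\<lambda>i. i \<in> marked n (s ''mem'')) [0..<n])"
  proof (rule runs_For[where I = "\<lambda>j s'. output_word s' =
      output_word s @ filter (\<lambda>i. i \<in> marked n (s ''mem'')) [0..<j]"])
    fix j s'
    assume j: "j < n" "s' ''x'' 0 = j"
      and fr: "\<forall>x. x \<notin> insert ''x'' (writes emit_step) \<longrightarrow> s' x = s x"
      and I: "output_word s' = output_word s @ filter (\<lambda>i. i \<in> marked n (s ''mem'')) [0..<j]"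
    have mem: "s' ''mem'' = s ''mem''" using fr by simp
    show "runs emit_step s' 3 (\<lambda>s''. output_word (s''(''x'' := (s'' ''x'')(0 := Suc j))) =
      output_word s @ filter (\<lambda>i. i \<in> marked n (s ''mem'')) [0..<Suc j])"
      unfolding emit_step_def
    proof (rule runs_Cond[where T = 2])
      assume "ram_eval (Cell ''mem'' (var ''x'')) s' \<noteq> 0"
      then have "j \<in> marked n (s ''mem'')" using j mem by (simp add: in_marked)
      then show "runs (push (var ''x'')) s' 2 (\<lambda>s''. output_word (s''(''x'' := (s'' ''x'')(0 := Suc j))) =
        output_word s @ filter (\<lambda>i. i \<in> marked n (s ''mem'')) [0..<Suc j])"
        using I j by (intro runs_conseq[OF runs_push]) auto
    next
      assume "ram_eval (Cell ''mem'' (var ''x'')) s' = 0"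
      then have "j \<notin> marked n (s ''mem'')" using j mem by (simp add: in_marked)
      then show "runs Skip s' 2 (\<lambda>s''. output_word (s''(''x'' := (s'' ''x'')(0 := Suc j))) =
        output_word s @ filter (\<lambda>i. i \<in> marked n (s ''mem'')) [0..<Suc j])"
        using I by (intro runs_Skip) auto
    qed simp
  qed (use assms in auto)
  then show ?thesis by (rule runs_conseq) auto
qed

text \<open>\<open>normalises\<close> as the program sees it, in terms of vertex numbers and the
  input word alone.\<close>

definition word_normalises :: "(nat \<Rightarrow> nat) \<Rightarrow> nat set \<Rightarrow> nat set \<Rightarrow> bool" where
  "word_normalises W A A' \<longleftrightarrow>
     (\<exists>T. A \<subseteq> T \<and> T \<subseteq> word_inner W \<and> card T \<le> size_bound W \<and>
          (card T = size_bound W \<or> T = word_inner W) \<and>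
          (A' = T \<and> (card T < size_bound W \<or> (\<forall>x\<in>T. \<not> word_separates W (T - {x}))) \<or>
           card T = size_bound W \<and> (\<exists>x\<in>T. A' = T - {x}) \<and> word_separates W A'))"

text \<open>\<open>p\<close> is an expression for the position \<open>q\<close> at which the set is
  listed, so that one argument serves both sets. The leading term of the time comes from the
  searches of the shrinking phase, at most one per vertex.\<close>

lemma runs_normalise:
  fixes s :: store
  defines "W \<equiv> s ''in''"
  assumes wf: "word_wf W" and L: "num_verts W \<le> L" "num_edges W \<le> L" "W q \<le> L"
    and p: "\<And>s'. s' ''in'' = W \<Longrightarrow> ram_eval p s' = q"
    and A_def: "A = (\<lambda>i. W (q + 1 + i)) ` {..<W q}"
    and A: "A \<subseteq> word_inner W" "card A = W q" "W q \<le> size_bound W"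
  shows "runs (normalise p) s (L * (L * (L * 6 + 4) + L * 3 + 12) + L * 19 + 13) (\<lambda>s'.
    \<exists>A'. word_normalises W A A' \<and>
      output_word s' = output_word s @ card A' # filter (\<lambda>i. i \<in> A') [0..<num_verts W])"
    (is "runs _ _ _ ?Q")
proof -
  let ?n = "num_verts W"
  let ?TS = "L * (L * (L * 6 + 4) + L * 3 + 12) + 2"
  have A_n: "A \<subseteq> {..<?n}" using A(1) by (auto simp: word_inner_def)
  have out: "output_word s' = output_word s" if "s' ''out'' = s ''out''" "s' ''outlen'' = s ''outlen''" for s'
    using that by (simp add: output_word_def)
  have "runs (normalise p) s ((L * 3 + 2) + ((L * 3 + 2) + (1 + ((L * 8 + 2) + (?TS + (2 + (L * 5 + 2))))))) ?Q"
    unfolding normalise_def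
  proof (rule runs_Seq[OF runs_clear _ order_refl])
    fix s1 :: store
    assume fr1: "\<forall>x. x \<notin> writes (clear ''x'' ''mem'') \<longrightarrow> s1 x = s x"
      and mem1: "marked (num_verts (s ''in'')) (s1 ''mem'') = {}"
    have in1: "s1 ''in'' = W" using fr1 by (simp add: W_def)
    have out1: "s1 ''out'' = s ''out''" "s1 ''outlen'' = s ''outlen''" using fr1 by auto
    show "runs (Seq (load p) (Seq (Assign ''size'' (Const 0) (input p))
           (Seq (For ''x'' e_n pad_step) (Seq (For ''x'' e_n shrink_step)
               (Seq (push (var ''size'')) (For ''x'' e_n emit_step))))))
      s1 ((L * 3 + 2) + (1 + ((L * 8 + 2) + (?TS + (2 + (L * 5 + 2)))))) ?Q"
    proof (rule runs_Seq[OF runs_load[of s1 p q L, unfolded in1] _ order_refl])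
      fix s2 :: store
      assume fr2: "\<forall>x. x \<notin> writes (load p) \<longrightarrow> s2 x = s1 x"
        and mem2: "marked ?n (s2 ''mem'') = (\<lambda>i. W (q + 1 + i)) ` {..<W q}"
      have in2: "s2 ''in'' = W" and out2: "s2 ''out'' = s ''out''" "s2 ''outlen'' = s ''outlen''"
        using fr2 in1 out1 by auto
      show "runs (Seq (Assign ''size'' (Const 0) (input p))
           (Seq (For ''x'' e_n pad_step) (Seq (For ''x'' e_n shrink_step)
               (Seq (push (var ''size'')) (For ''x'' e_n emit_step)))))
        s2 (1 + ((L * 8 + 2) + (?TS + (2 + (L * 5 + 2))))) ?Q"
        unfolding plus_1_eq_Suc
      proof (rule runs_Assign_Seq)
        let ?s3 = "s2(''size'' := (s2 ''size'')(ram_eval (Const 0) s2 := ram_eval (input p) s2))"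
        have in3: "?s3 ''in'' = W" and out3: "?s3 ''out'' = s ''out''" "?s3 ''outlen'' = s ''outlen''"
          and mem3: "marked ?n (?s3 ''mem'') = A" and size3: "?s3 ''size'' 0 = card A"
          using in2 out2 mem2 p[of s2, OF in2] A by (auto simp: A_def)
        show "runs (Seq (For ''x'' e_n pad_step) (Seq (For ''x'' e_n shrink_step)
               (Seq (push (var ''size'')) (For ''x'' e_n emit_step))))
          ?s3 ((L * 8 + 2) + (?TS + (2 + (L * 5 + 2)))) ?Q"
        proof (rule runs_Seq[OF runs_pad[of ?s3 L, unfolded in3 mem3] _ order_refl])
          fix s4 :: store
          assume fr4: "\<forall>x. x \<notin> writes (For ''x'' e_n pad_step) \<longrightarrow> s4 x = ?s3 x"
          define T where "T = marked ?n (s4 ''mem'')"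
          assume "let B = marked ?n (s4 ''mem'') in
            A \<subseteq> B \<and> B \<subseteq> word_inner W \<and> s4 ''size'' 0 = card B \<and> card B \<le> size_bound W \<and>
            (card B = size_bound W \<or> B = word_inner W)"
          then have T: "A \<subseteq> T" "T \<subseteq> word_inner W" "s4 ''size'' 0 = card T" "card T \<le> size_bound W"
            "card T = size_bound W \<or> T = word_inner W"
            by (auto simp: T_def Let_def)
          have in4: "s4 ''in'' = W" and out4: "s4 ''out'' = s ''out''" "s4 ''outlen'' = s ''outlen''"
            using fr4 in3 out3 by auto
          show "runs (Seq (For ''x'' e_n shrink_step) (Seq (push (var ''size'')) (For ''x'' e_n emit_step)))
            s4 (?TS + (2 + (L * 5 + 2))) ?Q"
          proof (rule runs_Seq[OF runs_shrink[of s4 L, unfolded in4, folded T_def, OF wf L(1,2) T(3,4)] _ order_refl])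
            fix s5 :: store
            assume fr5: "\<forall>x. x \<notin> writes (For ''x'' e_n shrink_step) \<longrightarrow> s5 x = s4 x"
            define A' where "A' = marked ?n (s5 ''mem'')"
            assume "let A' = marked ?n (s5 ''mem'') in s5 ''size'' 0 = card A' \<and>
              (A' = T \<and> (card T < size_bound W \<or> (\<forall>x\<in>T. \<not> word_separates W (T - {x}))) \<or>
               card T = size_bound W \<and> (\<exists>x\<in>T. A' = T - {x}) \<and> word_separates W A')"
            then have size5: "s5 ''size'' 0 = card A'"
              and norm: "A' = T \<and> (card T < size_bound W \<or> (\<forall>x\<in>T. \<not> word_separates W (T - {x}))) \<or>
               card T = size_bound W \<and> (\<exists>x\<in>T. A' = T - {x}) \<and> word_separates W A'"
              unfolding Let_def A'_def[symmetric] by simp_all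
            have in5: "s5 ''in'' = W" using fr5 in4 by simp
            have out5: "output_word s5 = output_word s" by (rule out) (use fr5 out4 in simp_all)
            have wn: "word_normalises W A A'"
              unfolding word_normalises_def by (rule exI[of _ T]) (intro conjI T(1,2,4,5) norm)
            show "runs (Seq (push (var ''size'')) (For ''x'' e_n emit_step)) s5 (2 + (L * 5 + 2)) ?Q"
            proof (rule runs_Seq[OF runs_push _ order_refl])
              fix s6 :: store
              assume fr6: "\<forall>x. x \<notin> writes (push (var ''size'')) \<longrightarrow> s6 x = s5 x"
                and out6: "output_word s6 = output_word s5 @ [ram_eval (var ''size'') s5]"
              have in6: "s6 ''in'' = W" and mem6: "s6 ''mem'' = s5 ''mem''" using fr6 in5 by auto
              show "runs (For ''x'' e_n emit_step) s6 (L * 5 + 2) ?Q"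
              proof (rule runs_conseq[OF runs_emit[of s6 L, unfolded in6 mem6, folded A'_def, OF L(1)] order_refl])
                fix s7 :: store
                assume "output_word s7 = output_word s6 @ filter (\<lambda>i. i \<in> A') [0..<?n]"
                then have "output_word s7 = output_word s @ card A' # filter (\<lambda>i. i \<in> A') [0..<?n]"
                  using out6 out5 size5 by simp
                then show "?Q s7" using wn by blast
              qed
            qed
          qed
        qed (use A size3 L in \<open>simp_all only:\<close>)
      qed
    next
      show "(\<lambda>i. W (q + 1 + i)) ` {..<W q} \<subseteq> {..<?n}" using A_n by (simp only: A_def)
      show "marked ?n (s1 ''mem'') = {}" using mem1 by (simp only: W_def)
    qed (use p L in auto)
  qed (use L in \<open>auto simp: W_def\<close>)
  then show ?thesis by (rule runs_conseq) auto
qed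


section \<open>Encoded instances\<close>

lemma input_store_nth:
  "w = p @ q @ r \<Longrightarrow> i < length q \<Longrightarrow> input_store w ''in'' (length p + i) = q ! i"
  by (simp add: input_store_def nth_append)

lemma length_concat_pairs: "length (concat (map (\<lambda>(x, y). [f x, f y]) es)) = length es + length es"
  by (induction es) auto

lemma nth_concat_pairs:
  "j < length es \<Longrightarrow> concat (map (\<lambda>(x, y). [f x, f y]) es) ! (j + j) = f (fst (es ! j)) \<and>
    concat (map (\<lambda>(x, y). [f x, f y]) es) ! Suc (j + j) = f (snd (es ! j))"
proof (induction es arbitrary: j)
  case (Cons e es)
  then show ?case by (cases j) (auto split: prod.splits)
qed simp

text \<open>Injectivity lets a walk in the image be lifted step by step, since each point it visits
  has a unique preimage in \<open>V\<close>.\<close>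

lemma rtrancl_map_prod_iff:
  assumes "inj_on f V" "r \<subseteq> V \<times> V" "x \<in> V" "y \<in> V"
  shows "(f x, f y) \<in> (map_prod f f ` r)\<^sup>* \<longleftrightarrow> (x, y) \<in> r\<^sup>*"
proof
  assume "(x, y) \<in> r\<^sup>*"
  then show "(f x, f y) \<in> (map_prod f f ` r)\<^sup>*"
  proof induction
    case (step y z)
    have "(f y, f z) \<in> map_prod f f ` r" using step.hyps(2) by force
    with step.IH show ?case by (rule rtrancl_into_rtrancl)
  qed simp
next
  \<comment> \<open>The end point is generalised to \<open>b\<close>, because intermediate points
    are not known beforehand to be images.\<close>
  have "\<exists>z\<in>V. b = f z \<and> (x, z) \<in> r\<^sup>*" if "(f x, b) \<in> (map_prod f f ` r)\<^sup>*" for b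
    using that
  proof induction
    case base
    then show ?case using assms(3) by blast
  next
    case (step a b)
    then obtain z where z: "z \<in> V" "a = f z" "(x, z) \<in> r\<^sup>*" by blast
    from step.hyps(2) obtain c d where cd: "(c, d) \<in> r" "a = f c" "b = f d" by auto
    then have "c = z" "d \<in> V" using inj_onD[OF assms(1), of c z] assms(2) z by auto
    then show ?case using z(3) cd by (auto intro!: bexI[of _ d] intro: rtrancl_into_rtrancl)
  qed
  moreover assume "(f x, f y) \<in> (map_prod f f ` r)\<^sup>*"
  ultimately obtain z where "z \<in> V" "f y = f z" "(x, z) \<in> r\<^sup>*" by blast
  then show "(x, y) \<in> r\<^sup>*" using inj_onD[OF assms(1), of y z] assms(4) by simp
qed

lemma runs_copy:
  fixes s :: store
  assumes N: "\<And>s'. s' ''in'' = s ''in'' \<Longrightarrow> s' ''inlen'' = s ''inlen'' \<Longrightarrow> ram_eval N s' = n"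
    and "n \<le> L"
  shows "runs (For ''x'' N (push (input (var ''x'')))) s (L * 4 + 2)
    (\<lambda>s'. output_word s' = output_word s @ map (s ''in'') [0..<n])"
proof -
  have "runs (For ''x'' N (push (input (var ''x'')))) s (L * (2 + 2) + 2)
    (\<lambda>s'. output_word s' = output_word s @ map (s ''in'') [0..<n])"
  proof (rule runs_For[where I = "\<lambda>j s'. output_word s' = output_word s @ map (s ''in'') [0..<j]"])
    fix j s'
    assume "\<forall>x. x \<notin> insert ''x'' (writes (push (input (var ''x'')))) \<longrightarrow> s' x = s x"
      and "s' ''x'' 0 = j" "output_word s' = output_word s @ map (s ''in'') [0..<j]"
    then show "runs (push (input (var ''x''))) s' 2
      (\<lambda>s''. output_word (s''(''x'' := (s'' ''x'')(0 := Suc j))) =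
        output_word s @ map (s ''in'') [0..<Suc j])"
      by (intro runs_conseq[OF runs_push]) auto
  qed (use assms in auto)
  then show ?thesis by (rule runs_conseq) auto
qed

section \<open>The word of an instance\<close>

text \<open>TJ and TAR instances share the graph and the terminals; what follows them is the
  parameter \<open>rest\<close>.\<close>

locale encoded_instance = two_terminals G u v
  for G :: "'a pair_pre_digraph" and u v :: 'a +
  fixes f :: "'a \<Rightarrow> nat" and vs :: "'a list" and es :: "('a \<times> 'a) list" and rest :: "nat list"
  assumes bij: "bij_betw f (pverts G) {..<card (pverts G)}"
    and vs: "distinct vs" "set vs = pverts G"
    and es: "set es \<union> (set es)\<inverse> = parcs G"
begin

definition header :: "nat list" where
  "header = (length vs # map f vs) @ (length es # concat (map (\<lambda>(x, y). [f x, f y]) es)) @ [f u, f v]"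

definition word :: "nat list" where
  "word = header @ rest"

definition W :: "nat \<Rightarrow> nat" where
  "W = input_store word ''in''"

lemma W_nth: "word = p @ q @ r \<Longrightarrow> i < length q \<Longrightarrow> W (length p + i) = q ! i"
  by (simp add: W_def input_store_nth)

lemma num_verts: "num_verts W = card (pverts G)"
  using W_nth[of "[]" "[length vs]" _ 0] distinct_card[OF vs(1)] vs(2)
  by (simp add: num_verts_def word_def header_def)

lemma length_vs: "length vs = card (pverts G)"
  using distinct_card[OF vs(1)] vs(2) by simp

lemma num_edges: "num_edges W = length es"
  using W_nth[of "length vs # map f vs" "[length es]" _ 0]
  by (simp add: num_edges_def num_verts length_vs word_def header_def)

lemma edge:
  assumes "j < length es"
  shows "edge_fst W j = f (fst (es ! j))" "edge_snd W j = f (snd (es ! j))"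
proof -
  let ?p = "(length vs # map f vs) @ [length es]"
    and ?q = "concat (map (\<lambda>(x, y). [f x, f y]) es)"
  have w: "word = ?p @ ?q @ [f u, f v] @ rest" by (simp add: word_def header_def)
  have "W (length ?p + (j + j)) = ?q ! (j + j)" "W (length ?p + Suc (j + j)) = ?q ! Suc (j + j)"
    by (rule W_nth[OF w], use assms in \<open>simp add: length_concat_pairs\<close>)+
  then show "edge_fst W j = f (fst (es ! j))" "edge_snd W j = f (snd (es ! j))"
    using nth_concat_pairs[OF assms, of f]
    by (simp_all add: edge_fst_def edge_snd_def num_verts length_vs numeral_3_eq_3)
qed

lemma src: "src W = f u" and tgt: "tgt W = f v"
proof -
  let ?p = "(length vs # map f vs) @ (length es # concat (map (\<lambda>(x, y). [f x, f y]) es))"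
  have w: "word = ?p @ [f u, f v] @ rest" by (simp add: word_def header_def)
  have "W (length ?p + 0) = f u" "W (length ?p + 1) = f v"
    using W_nth[OF w, of 0] W_nth[OF w, of 1] by simp_all
  then show "src W = f u" "tgt W = f v"
    by (simp_all add: src_def tgt_def edge_fst_def edge_snd_def num_verts num_edges length_vs
        length_concat_pairs numeral_3_eq_3)
qed

lemma pos_a: "pos_a W = length header"
  by (simp add: pos_a_def num_verts num_edges length_vs header_def length_concat_pairs)

lemma map_W: "map W [0..<length header] = header" "map W [0..<length word] = word"
  by (rule nth_equalityI; simp add: W_def input_store_def word_def nth_append)+

lemma inj: "inj_on f (pverts G)"
  using bij by (rule bij_betw_imp_inj_on)

lemma uv_verts: "u \<in> pverts G" "v \<in> pverts G"
  using two_terminal_graph by (auto simp: two_terminal_graph_def)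

lemma inner_verts: "S \<subseteq> inner \<Longrightarrow> S \<subseteq> pverts G"
  by (auto simp: inner_def)

lemma f_less: "x \<in> pverts G \<Longrightarrow> f x < card (pverts G)"
  using bij by (auto simp: bij_betw_def)

lemma arc_verts: "(x, y) \<in> parcs G \<Longrightarrow> x \<in> pverts G \<and> y \<in> pverts G"
proof -
  interpret pair_graph G using two_terminal_graph by (simp add: two_terminal_graph_def)
  show "(x, y) \<in> parcs G \<Longrightarrow> x \<in> pverts G \<and> y \<in> pverts G" using in_arcsD1 in_arcsD2 by blast
qed

lemma arcs_iff:
  "(x, y) \<in> parcs G \<longleftrightarrow> (\<exists>j<length es. es ! j = (x, y) \<or> es ! j = (y, x))"
  unfolding es[symmetric] by (auto simp: in_set_conv_nth)

lemma word_inner: "word_inner W = f ` inner"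
proof -
  have "f ` inner = f ` pverts G - f ` {u, v}"
    unfolding inner_def by (rule inj_on_image_set_diff[OF inj]) (use uv_verts in auto)
  then show ?thesis
    using bij by (simp add: word_inner_def num_verts src tgt bij_betw_def)
qed

lemma word_wf: "word_wf W"
proof -
  have "fst (es ! j) \<in> pverts G \<and> snd (es ! j) \<in> pverts G" if "j < length es" for j
    using arc_verts[of "fst (es ! j)" "snd (es ! j)"] arcs_iff[of "fst (es ! j)" "snd (es ! j)"] that
    by auto
  then show ?thesis
    using uv_verts f_less by (simp add: word_wf_def src tgt num_verts num_edges edge)
qed

lemma word_arcs:
  assumes "S \<subseteq> pverts G"
  shows "word_arcs W (f ` S) = map_prod f f ` arcs_avoiding S"
proof -
  have mem: "f x \<in> f ` S \<longleftrightarrow> x \<in> S" if "x \<in> pverts G" for x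
    using inj_on_image_mem_iff[OF inj that assms] .
  show ?thesis
  proof (intro equalityI subrelI)
    fix a b
    assume "(a, b) \<in> word_arcs W (f ` S)"
    then obtain j where j: "j < length es" "a \<notin> f ` S" "b \<notin> f ` S"
      "a = f (fst (es ! j)) \<and> b = f (snd (es ! j)) \<or> a = f (snd (es ! j)) \<and> b = f (fst (es ! j))"
      by (auto simp: word_arcs_def num_edges edge)
    then obtain x y where "(x, y) \<in> parcs G" "a = f x" "b = f y" "f x \<notin> f ` S" "f y \<notin> f ` S"
      using arcs_iff by (metis prod.collapse)
    then show "(a, b) \<in> map_prod f f ` arcs_avoiding S"
      by (auto simp: arcs_avoiding_def)
  next
    fix a b
    assume "(a, b) \<in> map_prod f f ` arcs_avoiding S"
    then obtain x y where xy: "(x, y) \<in> parcs G" "x \<notin> S" "y \<notin> S" "a = f x" "b = f y"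
      by (auto simp: arcs_avoiding_def)
    from xy(1) obtain j where j: "j < length es" "es ! j = (x, y) \<or> es ! j = (y, x)"
      using arcs_iff by blast
    have "(a, b) = (edge_fst W j, edge_snd W j) \<or> (a, b) = (edge_snd W j, edge_fst W j)"
      using j(2) xy(4,5) edge[OF j(1)] by auto
    moreover have "a \<notin> f ` S" "b \<notin> f ` S" using arc_verts[OF xy(1)] mem xy(2-5) by simp_all
    ultimately show "(a, b) \<in> word_arcs W (f ` S)"
      using j(1) unfolding word_arcs_def num_edges by blast
  qed
qed

text \<open>The numbering maps the arcs that avoid \<open>S\<close> onto those of the word and
  terminals to terminals, so reachability is the same on both sides.\<close>

lemma word_separates_iff:
  assumes S: "S \<subseteq> inner"
  shows "word_separates W (f ` S) \<longleftrightarrow> uv_separator G u v S"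
proof -
  have "(f u, f v) \<in> (word_arcs W (f ` S))\<^sup>* \<longleftrightarrow> (u, v) \<in> (arcs_avoiding S)\<^sup>*"
    unfolding word_arcs[OF inner_verts[OF S]]
    by (rule rtrancl_map_prod_iff[OF inj])
      (use uv_verts arc_verts in \<open>auto simp: arcs_avoiding_def\<close>)
  then show ?thesis using S by (simp add: word_separates_def separator_iff src tgt)
qed

text \<open>What the program builds lies in the image of \<open>inner\<close>, so \<open>T\<close>
  and \<open>A'\<close> can be pulled back along the injective numbering; sizes and separation tests
  agree.\<close>

lemma word_normalises:
  assumes "word_normalises W (f ` S) A'" "S \<subseteq> inner"
  shows "\<exists>S'. A' = f ` S' \<and> S' \<subseteq> inner \<and> normalises (size_bound W) S S'"
proof -
  let ?k = "size_bound W"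
  from assms(1) obtain T where T: "f ` S \<subseteq> T" "T \<subseteq> word_inner W" "card T \<le> ?k"
      "card T = ?k \<or> T = word_inner W"
    and A': "A' = T \<and> (card T < ?k \<or> (\<forall>x\<in>T. \<not> word_separates W (T - {x}))) \<or>
           card T = ?k \<and> (\<exists>x\<in>T. A' = T - {x}) \<and> word_separates W A'"
    unfolding word_normalises_def by blast
  from T(2) obtain T0 where T0: "T0 \<subseteq> inner" "T = f ` T0"
    unfolding word_inner by (auto simp: subset_image_iff)
  note V = inner_verts[OF T0(1)]
  have card: "card T = card T0" unfolding T0(2) using inj_on_subset[OF inj V] by (rule card_image)
  have sub: "S \<subseteq> T0"
    using T(1) inj_on_image_mem_iff[OF inj _ V] inner_verts[OF assms(2)] by (auto simp: T0(2))
  have full: "T0 = inner" if "T = word_inner W"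
    using that inj_on_image_eq_iff[OF inj V, of inner] inner_verts[of inner]
    by (simp add: word_inner T0(2))
  have diff: "T - {f x} = f ` (T0 - {x})" if "x \<in> T0" for x
    using inj_on_image_set_diff[OF inj, of T0 "{x}"] that V by (auto simp: T0(2))
  have sep: "word_separates W (T - {f x}) \<longleftrightarrow> uv_separator G u v (T0 - {x})" if "x \<in> T0" for x
    unfolding diff[OF that] using T0(1) by (intro word_separates_iff) auto
  from A' show ?thesis
  proof
    assume *: "A' = T \<and> (card T < ?k \<or> (\<forall>x\<in>T. \<not> word_separates W (T - {x})))"
    then have "card T0 < ?k \<or> (\<forall>x\<in>T0. \<not> uv_separator G u v (T0 - {x}))"
      using card sep T0(2) by auto
    then have "normalises ?k S T0"
      unfolding normalises_def using sub T0(1) T(3,4) full card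
      by (intro exI[of _ T0]) auto
    then show ?thesis using * T0 by blast
  next
    assume *: "card T = ?k \<and> (\<exists>x\<in>T. A' = T - {x}) \<and> word_separates W A'"
    then obtain x where x: "x \<in> T0" "A' = T - {f x}" using T0(2) by auto
    have "uv_separator G u v (T0 - {x})" using sep[OF x(1)] * x(2) by simp
    then have "normalises ?k S (T0 - {x})"
      unfolding normalises_def using sub T0(1) T(3) * card x(1)
      by (intro exI[of _ T0]) auto
    then show ?thesis using x diff T0(1) by (intro exI[of _ "T0 - {x}"]) auto
  qed
qed

text \<open>The program emits numbers in increasing order. \<open>enc_set\<close> admits any order,
  so the list of preimages is a witness.\<close>

lemma enc_set_filter:
  assumes "S \<subseteq> inner"
  shows "enc_set f S (card (f ` S) # filter (\<lambda>i. i \<in> f ` S) [0..<num_verts W])"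
proof -
  let ?g = "inv_into (pverts G) f" and ?ys = "filter (\<lambda>i. i \<in> f ` S) [0..<num_verts W]"
  note V = inner_verts[OF assms]
  have sub: "f ` S \<subseteq> {..<num_verts W}" using V f_less by (auto simp: num_verts)
  have set: "set ?ys = f ` S" using sub by auto
  have im: "f ` S \<subseteq> f ` pverts G" using V by blast
  have "distinct (map ?g ?ys)"
    using inj_on_inv_into[OF im] unfolding distinct_map set by simp
  moreover have "set (map ?g ?ys) = S"
    using V by (simp only: set_map set inv_into_image_cancel[OF inj])
  moreover have "map f (map ?g ?ys) = ?ys"
    unfolding map_map by (rule map_idI) (use im set in \<open>simp add: f_inv_into_f subset_iff\<close>)
  moreover have "card (f ` S) = length ?ys"
    using distinct_card[of ?ys] set by simp
  ultimately show ?thesis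
    unfolding enc_set_def by (intro exI[of _ "map ?g ?ys"]) simp
qed

lemma W_enc_set:
  assumes "word = p @ (length xs # map f xs) @ r"
  shows "W (length p) = length xs"
    and "(\<lambda>i. W (length p + 1 + i)) ` {..<length xs} = f ` set xs"
proof -
  show "W (length p) = length xs" using W_nth[OF assms, of 0] by simp
  have "W (length p + 1 + i) = map f xs ! i" if "i < length xs" for i
    using W_nth[of "p @ [length xs]" "map f xs" r i] assms that by simp
  then show "(\<lambda>i. W (length p + 1 + i)) ` {..<length xs} = f ` set xs"
    by (force simp: in_set_conv_nth)
qed

lemma input_store_word: "input_store word ''in'' = W" "input_store word ''inlen'' 0 = length word"
  "output_word (input_store word) = []"
  by (auto simp: W_def input_store_def output_word_def)

lemma length_word: "num_verts W \<le> length word" "num_edges W \<le> length word" "pos_a W \<le> length word"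
  by (auto simp: num_verts num_edges pos_a word_def header_def length_vs length_concat_pairs)

end

section \<open>The two reductions\<close>

text \<open>The word of a TJ instance has no entry for \<open>k\<close>; it is recovered as the
  length entry of the first set.\<close>

definition tj_to_tar :: ram_prog where
  "tj_to_tar =
     Seq (For ''x'' (var ''inlen'') (push (input (var ''x''))))
       (push (Plus (input e_a) (Const 1)))"

text \<open>The position of the first set is also the length of the header, so the loop copies the
  graph and the terminals and leaves out the old sets and \<open>k\<close>.\<close>

definition tar_to_tj :: ram_prog where
  "tar_to_tj =
     Seq (For ''x'' e_a (push (input (var ''x'')))) (Seq (normalise e_a) (normalise e_b))"

context encoded_instance
begin

lemma runs_tj_to_tar:
  assumes "rest = (length xs # map f xs) @ r"
  shows "runs tj_to_tar (input_store word) (4 * length word + 4)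
    (\<lambda>s'. output_word s' = word @ [length xs + 1])"
  unfolding tj_to_tar_def
proof (rule runs_Seq[OF runs_copy])
  let ?s = "input_store word"
  show "length word \<le> length word" by simp
  show "ram_eval (var ''inlen'') s' = length word" if "s' ''inlen'' = ?s ''inlen''" for s'
    using that by (simp add: input_store_word)
  fix s' :: store
  assume fr: "\<forall>x. x \<notin> writes (For ''x'' (var ''inlen'') (push (input (var ''x'')))) \<longrightarrow> s' x = ?s x"
    and out: "output_word s' = output_word ?s @ map (?s ''in'') [0..<length word]"
  have "s' ''in'' = W" using fr by (simp add: input_store_word)
  moreover have "W (pos_a W) = length xs"
    unfolding pos_a by (rule W_enc_set(1)[of _ _ r]) (unfold word_def, simp add: assms)
  ultimately show "runs (push (Plus (input e_a) (Const 1))) s' 2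
      (\<lambda>s'. output_word s' = word @ [length xs + 1])"
    using out by (intro runs_conseq[OF runs_push]) (auto simp: input_store_word map_W)
qed simp

lemma runs_tar_to_tj:
  assumes rest: "rest = (length xs # map f xs) @ (length ys # map f ys) @ [k]"
    and dist: "distinct xs" "distinct ys"
    and sub: "set xs \<subseteq> inner" "set ys \<subseteq> inner" and len: "length xs \<le> k" "length ys \<le> k"
  shows "runs tar_to_tj (input_store word) (100 * length word ^ 3 + 100) (\<lambda>s'.
    \<exists>A B a b. normalises k (set xs) A \<and> normalises k (set ys) B \<and>
      enc_set f A a \<and> enc_set f B b \<and> output_word s' = header @ a @ b)"
    (is "runs _ _ _ ?Q")
proof -
  let ?L = "length word" and ?s = "input_store word"
  let ?TN = "?L * (?L * (?L * 6 + 4) + ?L * 3 + 12) + ?L * 19 + 13"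
  let ?hb = "header @ (length xs # map f xs)"
  have wa: "word = header @ (length xs # map f xs) @ (length ys # map f ys) @ [k]"
    and wb: "word = ?hb @ (length ys # map f ys) @ [k]"
    and wk: "word = (?hb @ (length ys # map f ys)) @ [k] @ []"
    unfolding word_def by (simp_all add: rest)
  have a: "W (pos_a W) = length xs" "(\<lambda>i. W (pos_a W + 1 + i)) ` {..<length xs} = f ` set xs"
    unfolding pos_a by (rule W_enc_set[OF wa])+
  have pos_b: "pos_b W = length ?hb" using a(1) by (simp add: pos_b_def pos_a)
  have b: "W (pos_b W) = length ys" "(\<lambda>i. W (pos_b W + 1 + i)) ` {..<length ys} = f ` set ys"
    unfolding pos_b by (rule W_enc_set[OF wb])+
  have k: "size_bound W = k"
    using W_nth[OF wk, of 0] b(1) pos_b by (simp add: size_bound_def add.assoc)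
  have L: "length xs \<le> ?L" "length ys \<le> ?L" unfolding wa by simp_all
  have card: "card (f ` set zs) = length zs" if "distinct zs" "set zs \<subseteq> inner" for zs
    using card_image[OF inj_on_subset[OF inj inner_verts[OF that(2)]]] distinct_card[OF that(1)]
    by simp
  \<comment> \<open>Stated for an arbitrary position and list, as it is used for both separators.
    Output is appended, so the first result survives the second run.\<close>
  have norm: "runs (normalise p) s' ?TN (\<lambda>s''. \<exists>A a. normalises k (set zs) A \<and> enc_set f A a \<and>
      output_word s'' = output_word s' @ a)"
    if "s' ''in'' = W" "\<And>s'. s' ''in'' = W \<Longrightarrow> ram_eval p s' = q" "W q = length zs"
      "(\<lambda>i. W (q + 1 + i)) ` {..<length zs} = f ` set zs" "distinct zs" "set zs \<subseteq> inner"
      "length zs \<le> k" "length zs \<le> ?L" for p q zs s'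
  proof (rule runs_conseq[OF runs_normalise[of s' ?L q p "f ` set zs", unfolded that(1)] order_refl])
    show "word_wf W" by (rule word_wf)
    show "num_verts W \<le> ?L" "num_edges W \<le> ?L" by (rule length_word)+
    show "W q \<le> ?L" "W q \<le> size_bound W" "card (f ` set zs) = W q"
      using that card by (simp_all add: k)
    show "\<And>s'. s' ''in'' = W \<Longrightarrow> ram_eval p s' = q" by (rule that(2))
    show "f ` set zs = (\<lambda>i. W (q + 1 + i)) ` {..<W q}" using that(3,4) by simp
    show "f ` set zs \<subseteq> word_inner W" using that(6) by (auto simp: word_inner)
  next
    fix s'' :: store
    assume "\<exists>A'. word_normalises W (f ` set zs) A' \<and>
      output_word s'' = output_word s' @ card A' # filter (\<lambda>i. i \<in> A') [0..<num_verts W]"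
    then obtain A' where A': "word_normalises W (f ` set zs) A'"
      "output_word s'' = output_word s' @ card A' # filter (\<lambda>i. i \<in> A') [0..<num_verts W]" by blast
    from word_normalises[OF A'(1) that(6)] obtain A where
      "A' = f ` A" "A \<subseteq> inner" "normalises k (set zs) A" unfolding k by blast
    then show "\<exists>A a. normalises k (set zs) A \<and> enc_set f A a \<and> output_word s'' = output_word s' @ a"
      using enc_set_filter[of A] A'(2) by blast
  qed
  have "runs tar_to_tj ?s ((?L * 4 + 2) + (?TN + ?TN)) ?Q"
    unfolding tar_to_tj_def
  proof (rule runs_Seq[OF runs_copy _ order_refl])
    show "pos_a W \<le> ?L" by (rule length_word)
    show "ram_eval e_a s' = pos_a W" if "s' ''in'' = ?s ''in''" for s'
      using that by (simp add: input_store_word)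
    fix s1 :: store
    assume fr1: "\<forall>x. x \<notin> writes (For ''x'' e_a (push (input (var ''x'')))) \<longrightarrow> s1 x = ?s x"
      and "output_word s1 = output_word ?s @ map (?s ''in'') [0..<pos_a W]"
    then have out1: "output_word s1 = header" by (simp add: input_store_word pos_a map_W)
    have in1: "s1 ''in'' = W" using fr1 by (simp add: input_store_word)
    show "runs (Seq (normalise e_a) (normalise e_b)) s1 (?TN + ?TN) ?Q"
    proof (rule runs_Seq[OF norm[where s' = s1 and p = e_a and q = "pos_a W" and zs = xs, OF in1 _ a dist(1) sub(1) len(1) L(1)] _ order_refl])
      fix s2 :: store
      assume fr2: "\<forall>x. x \<notin> writes (normalise e_a) \<longrightarrow> s2 x = s1 x"
        and "\<exists>A a. normalises k (set xs) A \<and> enc_set f A a \<and> output_word s2 = output_word s1 @ a"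
      then obtain A a where A: "normalises k (set xs) A" "enc_set f A a" "output_word s2 = header @ a"
        using out1 by auto
      have in2: "s2 ''in'' = W" using fr2 in1 by simp
      show "runs (normalise e_b) s2 ?TN ?Q"
      proof (rule runs_conseq[OF norm[where s' = s2 and p = e_b and q = "pos_b W" and zs = ys, OF in2 _ b dist(2) sub(2) len(2) L(2)] order_refl])
        fix s3 :: store
        assume "\<exists>B b. normalises k (set ys) B \<and> enc_set f B b \<and> output_word s3 = output_word s2 @ b"
        then obtain B b where "normalises k (set ys) B" "enc_set f B b" "output_word s3 = header @ a @ b"
          using A(3) by auto
        then show "?Q s3" using A(1,2) by blast
      qed simp
    qed simp
  qed
  moreover have "(?L * 4 + 2) + (?TN + ?TN) \<le> 100 * ?L ^ 3 + 100"
  proof -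
    have "1 \<le> ?L" by (simp add: word_def header_def)
    then have "?L ^ 1 \<le> ?L ^ 3" "?L ^ 2 \<le> ?L ^ 3"
      using power_increasing[of 1 3 ?L] power_increasing[of 2 3 ?L] by simp_all
    \<comment> \<open>Each normalisation contributes \<open>6 * ?L ^ 3\<close>. The coefficients 12,
      14 and 66 add up to 92, and the lower powers do not exceed the cube, which leaves room below
      100.\<close>
    moreover have "(?L * 4 + 2) + (?TN + ?TN) = 12 * ?L ^ 3 + 14 * ?L ^ 2 + 66 * ?L ^ 1 + 28"
      by (simp add: algebra_simps power3_eq_cube power2_eq_square)
    ultimately show ?thesis by linarith
  qed
  ultimately show ?thesis by (rule runs_conseq) blast
qed

end

lemma runs_imp_ram_computes:
  "runs p (input_store w) T Q \<Longrightarrow> \<exists>t s'. ram_computes p w t (output_word s') \<and> t \<le> T \<and> Q s'"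
  by (auto simp: runs_def ram_computes_def)

text \<open>Turns the witnesses of an encoded graph into an instance of the locale;
  \<open>rest\<close> is chosen at each interpretation.\<close>

lemma enc_graphE:
  assumes "two_terminal_graph G u v" "enc_graph f G g"
  obtains vs es where "encoded_instance G u v f vs es"
    "g @ [f u, f v] = encoded_instance.header u v f vs es"
proof -
  from assms(2) obtain vs es where *: "bij_betw f (pverts G) {..<card (pverts G)}"
    "distinct vs" "set vs = pverts G" "set es \<union> (set es)\<inverse> = parcs G"
    "g = (length vs # map f vs) @ (length es # concat (map (\<lambda>(x, y). [f x, f y]) es))"
    by (auto simp: enc_graph_def enc_set_def enc_edges_def)
  have inst: "encoded_instance G u v f vs es"
    using assms(1) * by unfold_locales auto
  then interpret encoded_instance G u v f vs es .
  show thesis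
    by (rule that[OF inst]) (simp add: header_def *(5))
qed

lemma tj_to_tar_computes:
  assumes "two_terminal_graph G u v" "card Sa = k" "enc_TJ f G u v Sa Sb w"
  shows "\<exists>t w'. ram_computes tj_to_tar w t w' \<and> t \<le> 4 * length w + 4 \<and>
    enc_TAR f (k + 1) G u v Sa Sb w'"
proof -
  from assms(3) obtain g a b where w: "w = g @ [f u, f v] @ a @ b"
    and enc: "enc_graph f G g" "enc_set f Sa a" "enc_set f Sb b"
    by (auto simp: enc_TJ_def)
  from enc(2) obtain xs where xs: "distinct xs" "set xs = Sa" "a = length xs # map f xs"
    by (auto simp: enc_set_def)
  from enc_graphE[OF assms(1) enc(1)] obtain vs es where
    inst: "encoded_instance G u v f vs es" "g @ [f u, f v] = encoded_instance.header u v f vs es" .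
  interpret encoded_instance G u v f vs es "a @ b" by (rule inst(1))
  have word: "word = w" using inst(2) by (simp add: word_def w)
  have "length xs = k" using xs(1,2) assms(2) distinct_card[of xs] by simp
  then have "word @ [length xs + 1] = g @ [f u, f v] @ a @ b @ [k + 1]" unfolding word by (simp add: w)
  then have "enc_TAR f (k + 1) G u v Sa Sb (word @ [length xs + 1])"
    unfolding enc_TAR_def using enc by blast
  moreover have "a @ b = (length xs # map f xs) @ b" by (simp add: xs(3))
  from runs_imp_ram_computes[OF runs_tj_to_tar[OF this]] obtain t s' where
    "ram_computes tj_to_tar w t (output_word s')" "t \<le> 4 * length w + 4"
    "output_word s' = word @ [length xs + 1]" unfolding word by blast
  ultimately show ?thesis by metis
qed

lemma tar_to_tj_computes:
  assumes "two_terminal_graph G u v" "uv_separator G u v Sa" "uv_separator G u v Sb"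
    and "card Sa \<le> k" "card Sb \<le> k" and "enc_TAR f k G u v Sa Sb w"
  shows "\<exists>Sa' Sb' t w'. ram_computes tar_to_tj w t w' \<and> t \<le> 100 * length w ^ 3 + 100 \<and>
    enc_TJ f G u v Sa' Sb' w' \<and> two_terminals.normalises G u v k Sa Sa' \<and>
    two_terminals.normalises G u v k Sb Sb'"
proof -
  from assms(6) obtain g a b where w: "w = g @ [f u, f v] @ a @ b @ [k]"
    and enc: "enc_graph f G g" "enc_set f Sa a" "enc_set f Sb b"
    by (auto simp: enc_TAR_def)
  from enc(2) obtain xs where xs: "distinct xs" "set xs = Sa" "a = length xs # map f xs"
    by (auto simp: enc_set_def)
  from enc(3) obtain ys where ys: "distinct ys" "set ys = Sb" "b = length ys # map f ys"
    by (auto simp: enc_set_def)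
  from enc_graphE[OF assms(1) enc(1)] obtain vs es where
    inst: "encoded_instance G u v f vs es" "g @ [f u, f v] = encoded_instance.header u v f vs es" .
  interpret encoded_instance G u v f vs es "a @ b @ [k]" by (rule inst(1))
  have word: "word = w" using inst(2) by (simp add: word_def w)
  have len: "length xs \<le> k" "length ys \<le> k"
    using xs(1,2) ys(1,2) assms(4,5) distinct_card[of xs] distinct_card[of ys] by simp_all
  have sub: "set xs \<subseteq> inner" "set ys \<subseteq> inner"
    using separator_inner assms(2,3) xs(2) ys(2) by blast+
  have "a @ b @ [k] = (length xs # map f xs) @ (length ys # map f ys) @ [k]" using xs(3) ys(3) by simp
  from runs_imp_ram_computes[OF runs_tar_to_tj[OF this xs(1) ys(1) sub len], unfolded word xs(2) ys(2)]
  obtain t s' A B a' b' where *: "ram_computes tar_to_tj w t (output_word s')"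
    "t \<le> 100 * length w ^ 3 + 100" "normalises k Sa A" "normalises k Sb B"
    "enc_set f A a'" "enc_set f B b'" "output_word s' = header @ a' @ b'" by blast
  have "header @ a' @ b' = g @ [f u, f v] @ a' @ b'" unfolding inst(2)[symmetric] by simp
  then have "enc_TJ f G u v A B (header @ a' @ b')"
    unfolding enc_TJ_def using enc(1) *(5,6) by blast
  then show ?thesis using * by metis
qed

theorem theorem1:
  shows
    "(\<exists>P c. \<forall>(G :: 'a pair_pre_digraph) u v Sa Sb k.
        two_terminal_graph G u v \<and> uv_separator G u v Sa \<and> uv_separator G u v Sb \<and>
        card Sa = k \<and> card Sb = k \<longrightarrow>
          (TJ G u v Sa Sb \<longleftrightarrow> TAR (k + 1) G u v Sa Sb) \<and>
          (\<forall>f w. enc_TJ f G u v Sa Sb w \<longrightarrow>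
             (\<exists>t w'. ram_computes P w t w' \<and> t \<le> c * length w + c \<and>
                     enc_TAR f (k + 1) G u v Sa Sb w')) \<and>
          ereal_of_enat (dist_TJ G u v Sa Sb) = ereal_of_enat (dist_TAR (k + 1) G u v Sa Sb) / 2)
     \<and>
     (\<forall>(G :: 'a pair_pre_digraph) u v Sa Sb k.
        two_terminal_graph G u v \<and> uv_separator G u v Sa \<and> uv_separator G u v Sb \<and>
        Sa \<noteq> Sb \<and> card Sa \<le> card Sb \<and> card Sb = k \<and> minimal_uv_separator G u v Sb \<longrightarrow>
          \<not> TAR k G u v Sa Sb)
     \<and>
     (\<exists>P c d. \<forall>(G :: 'a pair_pre_digraph) u v Sa Sb k.
        two_terminal_graph G u v \<and> uv_separator G u v Sa \<and> uv_separator G u v Sb \<and>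
        card Sa \<le> k \<and> card Sb \<le> k \<and>
        \<not> (Sa \<noteq> Sb \<and> (minimal_uv_separator G u v Sa \<and> card Sa = k \<or>
                       minimal_uv_separator G u v Sb \<and> card Sb = k)) \<longrightarrow>
          (\<forall>f w. enc_TAR f k G u v Sa Sb w \<longrightarrow>
             (\<exists>Sa' Sb' t w'.
                ram_computes P w t w' \<and> t \<le> c * length w ^ d + c \<and>
                enc_TJ f G u v Sa' Sb' w' \<and>
                uv_separator G u v Sa' \<and> uv_separator G u v Sb' \<and>
                card Sa' = card Sb' \<and> card Sb' \<le> k \<and>
                (TAR k G u v Sa Sb \<longleftrightarrow> TJ G u v Sa' Sb') \<and>
                ereal_of_enat (dist_TJ G u v Sa' Sb') =
                  ereal_of_enat (dist_TAR k G u v Sa' Sb') / 2)))"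
proof (intro conjI)
  show "\<exists>P c. \<forall>(G :: 'a pair_pre_digraph) u v Sa Sb k.
        two_terminal_graph G u v \<and> uv_separator G u v Sa \<and> uv_separator G u v Sb \<and>
        card Sa = k \<and> card Sb = k \<longrightarrow>
          (TJ G u v Sa Sb \<longleftrightarrow> TAR (k + 1) G u v Sa Sb) \<and>
          (\<forall>f w. enc_TJ f G u v Sa Sb w \<longrightarrow>
             (\<exists>t w'. ram_computes P w t w' \<and> t \<le> c * length w + c \<and>
                     enc_TAR f (k + 1) G u v Sa Sb w')) \<and>
          ereal_of_enat (dist_TJ G u v Sa Sb) = ereal_of_enat (dist_TAR (k + 1) G u v Sa Sb) / 2"
  \<comment> \<open>Program and constant are fixed before the graph. Copying takes four steps per
    entry, and four more cover the loop overhead and the final entry.\<close>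
  proof (rule exI[of _ tj_to_tar], rule exI[of _ 4], intro allI impI, elim conjE)
    fix G :: "'a pair_pre_digraph" and u v :: 'a and Sa Sb :: "'a set" and k
    assume *: "two_terminal_graph G u v" "uv_separator G u v Sa" "card Sa = k" "card Sb = k"
    interpret two_terminals G u v by (rule two_terminals.intro[OF *(1)])
    show "(TJ G u v Sa Sb \<longleftrightarrow> TAR (k + 1) G u v Sa Sb) \<and>
          (\<forall>f w. enc_TJ f G u v Sa Sb w \<longrightarrow>
             (\<exists>t w'. ram_computes tj_to_tar w t w' \<and> t \<le> 4 * length w + 4 \<and>
                     enc_TAR f (k + 1) G u v Sa Sb w')) \<and>
          ereal_of_enat (dist_TJ G u v Sa Sb) = ereal_of_enat (dist_TAR (k + 1) G u v Sa Sb) / 2"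
      using TJ_iff_TAR[OF *(2-4)] dist_TJ_eq_half_dist_TAR[OF *(2-4)] tj_to_tar_computes[OF *(1,3)]
      by blast
  qed
next
  show "\<forall>(G :: 'a pair_pre_digraph) u v Sa Sb k.
        two_terminal_graph G u v \<and> uv_separator G u v Sa \<and> uv_separator G u v Sb \<and>
        Sa \<noteq> Sb \<and> card Sa \<le> card Sb \<and> card Sb = k \<and> minimal_uv_separator G u v Sb \<longrightarrow>
          \<not> TAR k G u v Sa Sb"
  proof (intro allI impI, elim conjE)
    fix G :: "'a pair_pre_digraph" and u v :: 'a and Sa Sb :: "'a set" and k
    assume *: "two_terminal_graph G u v" "uv_separator G u v Sa" "Sa \<noteq> Sb"
      "minimal_uv_separator G u v Sb" "card Sb = k"
    interpret two_terminals G u v by (rule two_terminals.intro[OF *(1)])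
    show "\<not> TAR k G u v Sa Sb" by (rule not_TAR_minimal_separator[OF *(2-5)])
  qed
next
  show "\<exists>P c d. \<forall>(G :: 'a pair_pre_digraph) u v Sa Sb k.
        two_terminal_graph G u v \<and> uv_separator G u v Sa \<and> uv_separator G u v Sb \<and>
        card Sa \<le> k \<and> card Sb \<le> k \<and>
        \<not> (Sa \<noteq> Sb \<and> (minimal_uv_separator G u v Sa \<and> card Sa = k \<or>
                       minimal_uv_separator G u v Sb \<and> card Sb = k)) \<longrightarrow>
          (\<forall>f w. enc_TAR f k G u v Sa Sb w \<longrightarrow>
             (\<exists>Sa' Sb' t w'.
                ram_computes P w t w' \<and> t \<le> c * length w ^ d + c \<and>
                enc_TJ f G u v Sa' Sb' w' \<and>
                uv_separator G u v Sa' \<and> uv_separator G u v Sb' \<and>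
                card Sa' = card Sb' \<and> card Sb' \<le> k \<and>
                (TAR k G u v Sa Sb \<longleftrightarrow> TJ G u v Sa' Sb') \<and>
                ereal_of_enat (dist_TJ G u v Sa' Sb') =
                  ereal_of_enat (dist_TAR k G u v Sa' Sb') / 2))"
  \<comment> \<open>The exponent 3 reflects at most one search per vertex for each set, each search
    with a round over all edges for every vertex.\<close>
  proof (rule exI[of _ tar_to_tj], rule exI[of _ 100], rule exI[of _ 3], intro allI impI, elim conjE)
    fix G :: "'a pair_pre_digraph" and u v :: 'a and Sa Sb :: "'a set" and k f w
    assume *: "two_terminal_graph G u v" "uv_separator G u v Sa" "uv_separator G u v Sb"
      "card Sa \<le> k" "card Sb \<le> k"
      and nontriv: "\<not> (Sa \<noteq> Sb \<and> (minimal_uv_separator G u v Sa \<and> card Sa = k \<or>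
                       minimal_uv_separator G u v Sb \<and> card Sb = k))"
      and enc: "enc_TAR f k G u v Sa Sb w"
    interpret two_terminals G u v by (rule two_terminals.intro[OF *(1)])
    from tar_to_tj_computes[OF * enc] obtain Sa' Sb' t w' where
      c: "ram_computes tar_to_tj w t w'" "t \<le> 100 * length w ^ 3 + 100"
        "enc_TJ f G u v Sa' Sb' w'" and norm: "normalises k Sa Sa'" "normalises k Sb Sb'" by blast
    show "\<exists>Sa' Sb' t w'.
                ram_computes tar_to_tj w t w' \<and> t \<le> 100 * length w ^ 3 + 100 \<and>
                enc_TJ f G u v Sa' Sb' w' \<and>
                uv_separator G u v Sa' \<and> uv_separator G u v Sb' \<and>
                card Sa' = card Sb' \<and> card Sb' \<le> k \<and>
                (TAR k G u v Sa Sb \<longleftrightarrow> TJ G u v Sa' Sb') \<and>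
                ereal_of_enat (dist_TJ G u v Sa' Sb') =
                  ereal_of_enat (dist_TAR k G u v Sa' Sb') / 2"
      using c TAR_iff_TJ_normalised[OF *(2-5) nontriv norm] by blast
  qed
qed

end
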